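(* Let $p\ge 3$ be a prime and let $a,b\in\mathcal{E}_p$ with $|a-1|_p<|b-1|_p$. Assume that $$g_{a,b}(u)=a\left(\frac{b^2u^2+1}{b^2+u^2}\right)$$ has three fixed points $x_0,x_1,x_2$ in $\mathbb{Q}_p$, where $x_0$ is the one in $\mathcal{E}_p$. Let $r=|b-1|_p$, $X=B_r(x_1^2)\cup B_r(x_2^2)$, and let $k_{a,b}:X\to\mathbb{Q}_p$ be the function $$k_{a,b}(x)=\left(\frac{a(b^2x+1)}{b^2+x}\right)^2 .$$ Then the dynamics $(J_{k_{a,b}},k_{a,b},|\cdot|_p)$ is isometrically conjugate to the full shift dynamics $(\Sigma,\sigma,d_{k_{a,b}})$ on two symbols; that is, there is a bijection $h:J_{k_{a,b}}\to\Sigma$ with $h\circ k_{a,b}=\sigma\circ h$ on $J_{k_{a,b}}$ and $d_{k_{a,b}}(h(x),h(y))=|x-y|_p$ for all $x,y\in J_{k_{a,b}}$.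
   Context: $\mathbb{Q}_p$ is the field of $p$-adic numbers with the $p$-adic absolute value $|\cdot|_p$ normalized by $|p|_p=1/p$. $\mathcal{E}_p=\{x\in\mathbb{Q}_p:\ |x-1|_p<1\}$ and $B_r(c)=\{x\in\mathbb{Q}_p:\ |x-c|_p<r\}$. A fixed point of $g_{a,b}$ is an $x\in\mathbb{Q}_p$ with $b^2+x^2\ne0$ and $g_{a,b}(x)=x$; under the assumptions exactly one fixed point lies in $\mathcal{E}_p$. The Julia set is $J_{k_{a,b}}=\bigcap_{n=0}^\infty k_{a,b}^{-n}(X)$, i.e. the set of $x\in X$ all of whose iterates under $k_{a,b}$ are defined and lie in $X$. Symbolic side: $\Sigma=\{1,2\}^{\{0,1,2,\dots\}}$ and $\sigma:\Sigma\to\Sigma$ is the left shift, $\sigma(s_0,s_1,s_2,\dots)=(s_1,s_2,\dots)$. For $j\in\{1,2\}$, $\tau_j$ is the integer such that $|k_{a,b}(x)-k_{a,b}(y)|_p=p^{\tau_j}|x-y|_p$ for all $x,y\in B_r(x_j^2)$. For $i\ne j$ in $\{1,2\}$, $\kappa(i,j)$ is the integer such that $|x_i^2-x_j^2|_p=p^{-\kappa(i,j)}$. For distinct $s=(s_0,s_1,\dots)$ and $t=(t_0,t_1,\dots)$ in $\Sigma$ put $n=\min\{i\ge 0:\ s_i\ne t_i\}$ and $$d_{k_{a,b}}(s,t)=\begin{cases}p^{-\tau_{s_0}-\tau_{s_1}-\cdots-\tau_{s_{n-1}}-\kappa(s_n,t_n)}, & n\neq 0,\\ p^{-\kappa(s_0,t_0)},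 & n=0,\end{cases}$$ and $d_{k_{a,b}}(s,s)=0$. *)

theory Defs
  imports "HOL-Analysis.Analysis" "Berlekamp_Zassenhaus.Finite_Field"
begin

section \<open>The \<open>p\<close>-adic absolute value on the rationals\<close>

definition rat_padic_abs :: "nat \<Rightarrow> rat \<Rightarrow> real" where
  "rat_padic_abs p q =
     (if q = 0 then 0
      else real p powi (int (multiplicity (int p) (snd (quotient_of q)))
                        - int (multiplicity (int p) (fst (quotient_of q)))))"

lemma rat_padic_abs_0 [simp]: "rat_padic_abs p 0 = 0"
  by (simp add: rat_padic_abs_def)

lemma rat_padic_abs_nonneg [simp]: "rat_padic_abs p q \<ge> 0"
  by (simp add: rat_padic_abs_def)

context
  fixes p :: nat
  assumes p: "prime p"
begin

lemma rat_padic_abs_divide: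
  assumes "m \<noteq> 0" "n \<noteq> 0"
  shows "rat_padic_abs p (of_int m / of_int n) =
           real p powi (int (multiplicity (int p) n) - int (multiplicity (int p) m))"
proof -
  define q :: rat where "q = of_int m / of_int n"
  obtain a b where ab: "quotient_of q = (a, b)" by fastforce
  have b: "b > 0" using quotient_of_denom_pos[OF ab] .
  have q: "q = of_int a / of_int b" using quotient_of_div[OF ab] .
  have "q \<noteq> 0" using assms by (simp add: q_def)
  then have a: "a \<noteq> 0" using q by auto
  have "(of_int (m * b) :: rat) = of_int (a * n)"
    using q b assms by (simp add: q_def field_simps)
  then have eq: "m * b = a * n" by (simp only: of_int_eq_iff)
  have pp: "prime (int p)" using p by simp
  have "multiplicity (int p) (m * b) = multiplicity (int p) m + multiplicity (int p) b"
    using pp assms b by (intro prime_elem_multiplicity_mult_distrib) auto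
  moreover have "multiplicity (int p) (a * n) = multiplicity (int p) a + multiplicity (int p) n"
    using pp assms a by (intro prime_elem_multiplicity_mult_distrib) auto
  ultimately have "int (multiplicity (int p) b) - int (multiplicity (int p) a)
      = int (multiplicity (int p) n) - int (multiplicity (int p) m)"
    using eq by simp
  with \<open>q \<noteq> 0\<close> ab show ?thesis
    by (simp add: rat_padic_abs_def flip: q_def)
qed

lemma rat_padic_abs_eq_0_iff [simp]: "rat_padic_abs p q = 0 \<longleftrightarrow> q = 0"
  using prime_gt_0_nat[OF p] by (simp add: rat_padic_abs_def power_int_eq_0_iff)

lemma rat_padic_abs_1 [simp]: "rat_padic_abs p 1 = 1"
  using rat_padic_abs_divide[of 1 1] by simp

lemma rat_padic_abs_p: "rat_padic_abs p (of_nat p) = 1 / real p"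
  using rat_padic_abs_divide[of "int p" 1] prime_gt_0_nat[OF p] p
  by (simp add: power_int_minus inverse_eq_divide)

lemma rat_padic_abs_minus [simp]: "rat_padic_abs p (- q) = rat_padic_abs p q"
proof (cases "q = 0")
  case False
  obtain a b where "b > 0" "q = of_int a / of_int b"
    by (metis quotient_of_div quotient_of_denom_pos surj_pair)
  with False show ?thesis
    using rat_padic_abs_divide[of a b] rat_padic_abs_divide[of "-a" b]
      multiplicity_normalize_right[of "int p" "-a"] multiplicity_normalize_right[of "int p" a]
    by simp
qed simp

lemma rat_padic_abs_minus_commute: "rat_padic_abs p (x - y) = rat_padic_abs p (y - x)"
  using rat_padic_abs_minus[of "x - y"] by simp

lemma rat_padic_abs_mult: "rat_padic_abs p (x * y) = rat_padic_abs p x * rat_padic_abs p y"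
proof (cases "x = 0 \<or> y = 0")
  case False
  obtain a b where ab: "b > 0" "x = of_int a / of_int b"
    by (metis quotient_of_div quotient_of_denom_pos surj_pair)
  obtain c d where cd: "d > 0" "y = of_int c / of_int d"
    by (metis quotient_of_div quotient_of_denom_pos surj_pair)
  have nz: "a \<noteq> 0" "b \<noteq> 0" "c \<noteq> 0" "d \<noteq> 0" using ab cd False by auto
  have pp: "prime (int p)" using p by simp
  have p0: "real p \<noteq> 0" using prime_gt_0_nat[OF p] by simp
  have "rat_padic_abs p (x * y) = rat_padic_abs p (of_int (a * c) / of_int (b * d))"
    by (simp add: ab cd)
  also have "\<dots> = real p powi (int (multiplicity (int p) (b * d)) - int (multiplicity (int p) (a * c)))"
    using nz by (intro rat_padic_abs_divide) auto
  also have "multiplicity (int p) (b * d) = multiplicity (int p) b + multiplicity (int p) d"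
    using pp nz by (intro prime_elem_multiplicity_mult_distrib) auto
  also have "multiplicity (int p) (a * c) = multiplicity (int p) a + multiplicity (int p) c"
    using pp nz by (intro prime_elem_multiplicity_mult_distrib) auto
  finally show ?thesis
    using nz p0 ab cd
    by (simp add: rat_padic_abs_divide algebra_simps flip: power_int_add)
qed auto

lemma rat_padic_abs_inverse: "rat_padic_abs p (inverse x) = inverse (rat_padic_abs p x)"
proof (cases "x = 0")
  case False
  have "rat_padic_abs p (inverse x) * rat_padic_abs p x = 1"
    using False by (simp flip: rat_padic_abs_mult)
  with False show ?thesis by (simp add: field_simps)
qed simp

lemma rat_padic_abs_ultrametric:
  "rat_padic_abs p (x + y) \<le> max (rat_padic_abs p x) (rat_padic_abs p y)"
proof -
  have *: "rat_padic_abs p (1 + z) \<le> 1" if z: "rat_padic_abs p z \<le> 1" for z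
  proof (cases "z = 0 \<or> 1 + z = 0")
    case False
    obtain a b where qab: "quotient_of z = (a, b)" by fastforce
    have b: "b > 0" and zab: "z = of_int a / of_int b" and cop: "coprime a b"
      using quotient_of_denom_pos[OF qab] quotient_of_div[OF qab] quotient_of_coprime[OF qab] .
    have a: "a \<noteq> 0" using False zab by auto
    have p1: "real p > 1" using prime_gt_1_nat[OF p] by simp
    have "\<not> int p dvd b"
    proof
      assume dvd: "int p dvd b"
      then have "\<not> int p dvd a"
        using cop p by (meson coprime_common_divisor not_prime_unit prime_nat_int_transfer)
      then have "multiplicity (int p) a = 0" by (simp add: not_dvd_imp_multiplicity_0)
      moreover have "multiplicity (int p) b > 0"
        using dvd b p by (simp add: prime_multiplicity_gt_zero_iff)
      ultimately have "rat_padic_abs p z > 1"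
        using a b p1 by (simp add: zab rat_padic_abs_divide)
      with z show False by simp
    qed
    then have mb: "multiplicity (int p) b = 0" by (simp add: not_dvd_imp_multiplicity_0)
    have eq: "1 + z = of_int (a + b) / of_int b" using b by (simp add: zab field_simps)
    have "a + b \<noteq> 0" using False eq by auto
    have "rat_padic_abs p (1 + z) = real p powi (- int (multiplicity (int p) (a + b)))"
      using b \<open>a + b \<noteq> 0\<close> by (subst eq, subst rat_padic_abs_divide) (auto simp: mb)
    also have "\<dots> \<le> 1" using p1 by (simp add: power_int_minus inverse_le_1_iff)
    finally show ?thesis .
  qed auto
  have **: "rat_padic_abs p (x + y) \<le> rat_padic_abs p x"
    if le: "rat_padic_abs p y \<le> rat_padic_abs p x" for x y
  proof (cases "x = 0")
    case True
    then have "rat_padic_abs p y = 0"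
      using le rat_padic_abs_nonneg[of p y] by simp
    with True show ?thesis by simp
  next
    case False
    have pos: "rat_padic_abs p x > 0"
      using False rat_padic_abs_nonneg[of p x] by (simp add: less_le)
    have "x + y = x * (1 + y / x)" using False by (simp add: field_simps)
    moreover have "rat_padic_abs p (y / x) \<le> 1"
      using le pos unfolding divide_inverse rat_padic_abs_mult rat_padic_abs_inverse
      by (simp add: field_simps)
    ultimately have "rat_padic_abs p (x + y) \<le> rat_padic_abs p x * 1"
      using *[of "y / x"] by (simp only: rat_padic_abs_mult) (intro mult_left_mono, auto)
    then show ?thesis by simp
  qed
  show ?thesis
    using **[of y x] **[of x y] by (simp add: add.commute max_def)
qed

lemma rat_padic_abs_triangle: "rat_padic_abs p (x + y) \<le> rat_padic_abs p x + rat_padic_abs p y"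
  using rat_padic_abs_ultrametric[of x y] rat_padic_abs_nonneg[of p x] rat_padic_abs_nonneg[of p y]
  by linarith

lemma rat_padic_abs_triangle_rev:
  "\<bar>rat_padic_abs p x - rat_padic_abs p y\<bar> \<le> rat_padic_abs p (x - y)"
  using rat_padic_abs_triangle[of "x - y" y] rat_padic_abs_triangle[of "y - x" x]
    rat_padic_abs_minus_commute[of x y] by simp

end


section \<open>Cauchy sequences and null sequences\<close>

definition padic_null :: "nat \<Rightarrow> (nat \<Rightarrow> rat) \<Rightarrow> bool" where
  "padic_null p X \<longleftrightarrow> (\<lambda>n. rat_padic_abs p (X n)) \<longlonglongrightarrow> 0"

definition padic_cauchy :: "nat \<Rightarrow> (nat \<Rightarrow> rat) \<Rightarrow> bool" where
  "padic_cauchy p X \<longleftrightarrow> (\<forall>e>0. \<exists>N. \<forall>m\<ge>N. \<forall>n\<ge>N. rat_padic_abs p (X m - X n) < e)"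

definition padic_rel :: "nat \<Rightarrow> (nat \<Rightarrow> rat) \<Rightarrow> (nat \<Rightarrow> rat) \<Rightarrow> bool" where
  "padic_rel p X Y \<longleftrightarrow> padic_cauchy p X \<and> padic_cauchy p Y \<and> padic_null p (\<lambda>n. X n - Y n)"

lemma padic_cauchy_const [simp]: "padic_cauchy p (\<lambda>n. c)"
  by (simp add: padic_cauchy_def)

lemma padic_null_0 [simp]: "padic_null p (\<lambda>n. 0)"
  by (simp add: padic_null_def)

lemma padic_rel_refl: "padic_rel p X X \<longleftrightarrow> padic_cauchy p X"
  by (simp add: padic_rel_def)

context
  fixes p :: nat
  assumes p: "prime p"
begin

lemma padic_null_bound:
  assumes "Y \<longlonglongrightarrow> 0" "\<And>n. rat_padic_abs p (X n) \<le> Y n"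
  shows "padic_null p X"
  unfolding padic_null_def
  by (rule tendsto_sandwich[OF _ _ tendsto_const assms(1)]) (auto simp: assms(2))

lemma padic_null_add:
  assumes "padic_null p X" "padic_null p Y"
  shows "padic_null p (\<lambda>n. X n + Y n)"
  by (rule padic_null_bound[where Y = "\<lambda>n. rat_padic_abs p (X n) + rat_padic_abs p (Y n)"])
     (use tendsto_add[OF assms[unfolded padic_null_def]] rat_padic_abs_triangle[OF p] in auto)

lemma padic_null_minus: "padic_null p X \<Longrightarrow> padic_null p (\<lambda>n. - X n)"
  by (simp add: padic_null_def rat_padic_abs_minus[OF p])

lemma padic_null_diff_commute:
  "padic_null p (\<lambda>n. X n - Y n) \<Longrightarrow> padic_null p (\<lambda>n. Y n - X n)"
  using padic_null_minus[of "\<lambda>n. X n - Y n"] by simp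

lemma padic_null_const_iff [simp]: "padic_null p (\<lambda>n. c) \<longleftrightarrow> c = 0"
  by (simp add: padic_null_def LIMSEQ_const_iff rat_padic_abs_eq_0_iff[OF p])

lemma padic_cauchy_add:
  assumes "padic_cauchy p X" "padic_cauchy p Y"
  shows "padic_cauchy p (\<lambda>n. X n + Y n)"
  unfolding padic_cauchy_def
proof (intro allI impI)
  fix e :: real assume e: "e > 0"
  obtain M where M: "\<And>m n. m \<ge> M \<Longrightarrow> n \<ge> M \<Longrightarrow> rat_padic_abs p (X m - X n) < e"
    using assms(1) e unfolding padic_cauchy_def by blast
  obtain N where N: "\<And>m n. m \<ge> N \<Longrightarrow> n \<ge> N \<Longrightarrow> rat_padic_abs p (Y m - Y n) < e"
    using assms(2) e unfolding padic_cauchy_def by blast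
  have "rat_padic_abs p (X m + Y m - (X n + Y n)) < e" if "m \<ge> max M N" "n \<ge> max M N" for m n
    using rat_padic_abs_ultrametric[OF p, of "X m - X n" "Y m - Y n"] M[of m n] N[of m n] that
    by (simp add: algebra_simps)
  then show "\<exists>N. \<forall>m\<ge>N. \<forall>n\<ge>N. rat_padic_abs p (X m + Y m - (X n + Y n)) < e" by blast
qed

lemma padic_cauchy_minus: "padic_cauchy p X \<Longrightarrow> padic_cauchy p (\<lambda>n. - X n)"
  unfolding padic_cauchy_def minus_diff_minus rat_padic_abs_minus[OF p] .

lemma padic_cauchy_abs_convergent:
  assumes "padic_cauchy p X"
  shows "convergent (\<lambda>n. rat_padic_abs p (X n))"
proof (rule Cauchy_convergent, rule metric_CauchyI)
  fix e :: real assume "e > 0"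
  then obtain N where "\<And>m n. m \<ge> N \<Longrightarrow> n \<ge> N \<Longrightarrow> rat_padic_abs p (X m - X n) < e"
    using assms unfolding padic_cauchy_def by blast
  then show "\<exists>N. \<forall>m\<ge>N. \<forall>n\<ge>N. dist (rat_padic_abs p (X m)) (rat_padic_abs p (X n)) < e"
    using rat_padic_abs_triangle_rev[OF p] unfolding dist_real_def by (meson le_less_trans)
qed

lemma padic_cauchy_bounded:
  assumes "padic_cauchy p X"
  obtains B where "B > 0" "\<And>n. rat_padic_abs p (X n) \<le> B"
  using convergent_imp_Bseq[OF padic_cauchy_abs_convergent[OF assms]]
  by (auto simp: Bseq_def)

lemma padic_null_mult:
  assumes "padic_cauchy p X" "padic_null p Y"
  shows "padic_null p (\<lambda>n. X n * Y n)"
proof -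
  obtain B where B: "B > 0" "\<And>n. rat_padic_abs p (X n) \<le> B"
    using padic_cauchy_bounded[OF assms(1)] by blast
  show ?thesis
  proof (rule padic_null_bound)
    show "(\<lambda>n. B * rat_padic_abs p (Y n)) \<longlonglongrightarrow> 0"
      using tendsto_mult_right_zero assms(2) unfolding padic_null_def by blast
    show "rat_padic_abs p (X n * Y n) \<le> B * rat_padic_abs p (Y n)" for n
      by (simp add: rat_padic_abs_mult[OF p] mult_right_mono B)
  qed
qed

lemma padic_cauchy_mult:
  assumes "padic_cauchy p X" "padic_cauchy p Y"
  shows "padic_cauchy p (\<lambda>n. X n * Y n)"
  unfolding padic_cauchy_def
proof (intro allI impI)
  fix e :: real assume e: "e > 0"
  obtain A where A: "A > 0" "\<And>n. rat_padic_abs p (X n) \<le> A"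
    using padic_cauchy_bounded[OF assms(1)] by blast
  obtain B where B: "B > 0" "\<And>n. rat_padic_abs p (Y n) \<le> B"
    using padic_cauchy_bounded[OF assms(2)] by blast
  obtain M where M: "\<And>m n. m \<ge> M \<Longrightarrow> n \<ge> M \<Longrightarrow> rat_padic_abs p (X m - X n) < e / B"
    using assms(1) e B(1) unfolding padic_cauchy_def by (meson divide_pos_pos)
  obtain N where N: "\<And>m n. m \<ge> N \<Longrightarrow> n \<ge> N \<Longrightarrow> rat_padic_abs p (Y m - Y n) < e / A"
    using assms(2) e A(1) unfolding padic_cauchy_def by (meson divide_pos_pos)
  have "rat_padic_abs p (X m * Y m - X n * Y n) < e" if mn: "m \<ge> max M N" "n \<ge> max M N" for m n
  proof -
    have "rat_padic_abs p (X m * (Y m - Y n)) \<le> A * rat_padic_abs p (Y m - Y n)"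
      by (simp add: rat_padic_abs_mult[OF p] mult_right_mono A)
    also have "\<dots> < e" using N[of m n] mn A(1) by (simp add: field_simps)
    finally have 1: "rat_padic_abs p (X m * (Y m - Y n)) < e" .
    have "rat_padic_abs p ((X m - X n) * Y n) \<le> rat_padic_abs p (X m - X n) * B"
      by (simp add: rat_padic_abs_mult[OF p] mult_left_mono B)
    also have "\<dots> < e" using M[of m n] mn B(1) by (simp add: field_simps)
    finally have 2: "rat_padic_abs p ((X m - X n) * Y n) < e" .
    show ?thesis
      using 1 2 rat_padic_abs_ultrametric[OF p, of "X m * (Y m - Y n)" "(X m - X n) * Y n"]
      by (simp add: algebra_simps)
  qed
  then show "\<exists>N. \<forall>m\<ge>N. \<forall>n\<ge>N. rat_padic_abs p (X m * Y m - X n * Y n) < e" by blast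
qed

lemma padic_cauchy_not_null:
  assumes "padic_cauchy p X" "\<not> padic_null p X"
  obtains c N where "c > 0" "\<And>n. n \<ge> N \<Longrightarrow> rat_padic_abs p (X n) > c"
proof -
  obtain L where L: "(\<lambda>n. rat_padic_abs p (X n)) \<longlonglongrightarrow> L"
    using padic_cauchy_abs_convergent[OF assms(1)] by (auto simp: convergent_def)
  have "L \<ge> 0" using L by (rule LIMSEQ_le_const) auto
  moreover have "L \<noteq> 0" using L assms(2) by (auto simp: padic_null_def)
  ultimately have "L > 0" by simp
  then have "\<forall>\<^sub>F n in sequentially. rat_padic_abs p (X n) > L / 2"
    using order_tendstoD(1)[OF L, of "L / 2"] by simp
  with \<open>L > 0\<close> show thesis
    using that[of "L / 2"] by (auto simp: eventually_sequentially)
qed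

lemma rat_padic_abs_diff_inverse:
  assumes "x \<noteq> 0" "y \<noteq> 0"
  shows "rat_padic_abs p (inverse x - inverse y) =
           rat_padic_abs p (x - y) * inverse (rat_padic_abs p x) * inverse (rat_padic_abs p y)"
proof -
  have "inverse x - inverse y = - ((x - y) * inverse x * inverse y)"
    using assms by (simp add: field_simps)
  then show ?thesis
    by (simp only: rat_padic_abs_minus[OF p] rat_padic_abs_mult[OF p] rat_padic_abs_inverse[OF p])
qed

lemma padic_cauchy_inverse:
  assumes "padic_cauchy p X" "\<not> padic_null p X"
  shows "padic_cauchy p (\<lambda>n. inverse (X n))"
  unfolding padic_cauchy_def
proof (intro allI impI)
  fix e :: real assume e: "e > 0"
  obtain c M where c: "c > 0" "\<And>n. n \<ge> M \<Longrightarrow> rat_padic_abs p (X n) > c"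
    using padic_cauchy_not_null[OF assms] by blast
  obtain N where N: "\<And>m n. m \<ge> N \<Longrightarrow> n \<ge> N \<Longrightarrow> rat_padic_abs p (X m - X n) < e * c * c"
    using assms(1) e c(1) unfolding padic_cauchy_def by (meson mult_pos_pos)
  have "rat_padic_abs p (inverse (X m) - inverse (X n)) < e"
    if mn: "m \<ge> max M N" "n \<ge> max M N" for m n
  proof -
    have gt: "rat_padic_abs p (X m) > c" "rat_padic_abs p (X n) > c" using c mn by auto
    then have nz: "X m \<noteq> 0" "X n \<noteq> 0" using c(1) by auto
    have "rat_padic_abs p (X m - X n) * inverse (rat_padic_abs p (X m)) * inverse (rat_padic_abs p (X n))
        \<le> rat_padic_abs p (X m - X n) * inverse c * inverse c"
      using gt c(1) by (intro mult_mono le_imp_inverse_le) auto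
    also have "\<dots> < e * c * c * inverse c * inverse c"
      using N[of m n] mn c(1) by (intro mult_strict_right_mono) auto
    also have "\<dots> = e" using c(1) by (simp add: field_simps)
    finally show ?thesis using rat_padic_abs_diff_inverse[OF nz] by simp
  qed
  then show "\<exists>N. \<forall>m\<ge>N. \<forall>n\<ge>N. rat_padic_abs p (inverse (X m) - inverse (X n)) < e" by blast
qed

lemma padic_null_eventually_0:
  assumes "\<And>n. n \<ge> N \<Longrightarrow> X n = 0"
  shows "padic_null p X"
  unfolding padic_null_def
  by (rule tendsto_eventually) (auto simp: eventually_sequentially assms intro!: exI[of _ N])

lemma padic_null_inverse_mult:
  assumes "padic_cauchy p X" "\<not> padic_null p X"
  shows "padic_null p (\<lambda>n. inverse (X n) * X n - 1)"
proof -
  obtain c N where c: "c > 0" "\<And>n. n \<ge> N \<Longrightarrow> rat_padic_abs p (X n) > c"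
    using padic_cauchy_not_null[OF assms] by blast
  have "X n \<noteq> 0" if "n \<ge> N" for n using c(2)[OF that] c(1) by auto
  then show ?thesis by (intro padic_null_eventually_0[of N]) auto
qed

lemma padic_rel_null_iff:
  assumes "padic_rel p X Y"
  shows "padic_null p X \<longleftrightarrow> padic_null p Y"
  using padic_null_add[of Y "\<lambda>n. X n - Y n"] padic_null_add[of X "\<lambda>n. Y n - X n"]
    padic_null_diff_commute[of X Y] assms by (auto simp: padic_rel_def)

lemma part_equivp_padic_rel: "part_equivp (padic_rel p)"
proof (rule part_equivpI)
  show "\<exists>x. padic_rel p x x" using padic_rel_refl padic_cauchy_const by blast
  show "symp (padic_rel p)"
    by (auto simp: symp_def padic_rel_def intro: padic_null_diff_commute)
  show "transp (padic_rel p)"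
  proof (rule transpI)
    fix X Y Z assume "padic_rel p X Y" "padic_rel p Y Z"
    then show "padic_rel p X Z"
      using padic_null_add[of "\<lambda>n. X n - Y n" "\<lambda>n. Y n - Z n"] by (auto simp: padic_rel_def)
  qed
qed

lemma padic_rel_mult:
  assumes "padic_rel p X X'" "padic_rel p Y Y'"
  shows "padic_rel p (\<lambda>n. X n * Y n) (\<lambda>n. X' n * Y' n)"
proof -
  have "padic_null p (\<lambda>n. X n * (Y n - Y' n) + Y' n * (X n - X' n))"
    using assms by (intro padic_null_add padic_null_mult) (auto simp: padic_rel_def)
  then show ?thesis
    using assms by (auto simp: padic_rel_def padic_cauchy_mult algebra_simps)
qed

lemma padic_rel_inverse:
  assumes XY: "padic_rel p X Y"
  shows "padic_rel p (if padic_null p X then (\<lambda>n. 0) else (\<lambda>n. inverse (X n)))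
                     (if padic_null p Y then (\<lambda>n. 0) else (\<lambda>n. inverse (Y n)))"
proof (cases "padic_null p X")
  case True
  then show ?thesis using padic_rel_null_iff[OF XY] by (simp add: padic_rel_refl)
next
  case False
  then have nY: "\<not> padic_null p Y" using padic_rel_null_iff[OF XY] by simp
  have cX: "padic_cauchy p X" and cY: "padic_cauchy p Y" and n: "padic_null p (\<lambda>n. X n - Y n)"
    using XY by (auto simp: padic_rel_def)
  note iX = padic_cauchy_inverse[OF cX False] and iY = padic_cauchy_inverse[OF cY nY]
  have 1: "padic_null p (\<lambda>n. inverse (X n) * (inverse (Y n) * (Y n - X n)))"
    by (intro padic_null_mult iX iY padic_null_diff_commute[OF n])
  have 2: "padic_null p (\<lambda>n. inverse (Y n) * (inverse (X n) * X n - 1))"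
    by (intro padic_null_mult iY padic_null_inverse_mult cX False)
  have 3: "padic_null p (\<lambda>n. - (inverse (X n) * (inverse (Y n) * Y n - 1)))"
    by (intro padic_null_minus padic_null_mult iX padic_null_inverse_mult cY nY)
  have "padic_null p (\<lambda>n. (inverse (X n) * (inverse (Y n) * (Y n - X n))
      + inverse (Y n) * (inverse (X n) * X n - 1)) + - (inverse (X n) * (inverse (Y n) * Y n - 1)))"
    by (intro padic_null_add 1 2 3)
  then have "padic_null p (\<lambda>n. inverse (X n) - inverse (Y n))"
    by (simp add: algebra_simps)
  then show ?thesis
    using False nY iX iY by (simp add: padic_rel_def)
qed

lemma padic_rel_lim_eq:
  assumes "padic_rel p X Y"
  shows "lim (\<lambda>n. rat_padic_abs p (X n)) = lim (\<lambda>n. rat_padic_abs p (Y n))"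
proof -
  have "(\<lambda>n. rat_padic_abs p (X n)) \<longlonglongrightarrow> lim (\<lambda>n. rat_padic_abs p (X n))"
    using padic_cauchy_abs_convergent assms by (simp add: padic_rel_def convergent_LIMSEQ_iff)
  moreover have "(\<lambda>n. rat_padic_abs p (X n) - rat_padic_abs p (Y n)) \<longlonglongrightarrow> 0"
    by (rule Lim_null_comparison[where g = "\<lambda>n. rat_padic_abs p (X n - Y n)"])
       (use assms rat_padic_abs_triangle_rev[OF p] in \<open>auto simp: padic_rel_def padic_null_def\<close>)
  ultimately have "(\<lambda>n. rat_padic_abs p (Y n)) \<longlonglongrightarrow> lim (\<lambda>n. rat_padic_abs p (X n))"
    using tendsto_diff by fastforce
  then show ?thesis by (simp add: limI)
qed

end


section \<open>The field \<open>\<rat>\<^sub>p\<close>\<close>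

text \<open>
  The prime is carried by the type parameter, \<open>p = CARD('p)\<close>, so that \<open>\<rat>\<^sub>p\<close> is a type and
  hence an instance of the class \<^class>\<open>field\<close>. As a set it is the completion of \<open>\<rat>\<close> with respect
  to the \<open>p\<close>-adic absolute value: rational Cauchy sequences modulo null sequences.
\<close>

typedef ('p::prime_card) padic =
  "{C. \<exists>X. padic_rel CARD('p) X X \<and> C = Collect (padic_rel CARD('p) X)}"
  by (rule part_equivp_typedef[OF part_equivp_padic_rel[OF prime_card]])

definition padic_of_seq :: "(nat \<Rightarrow> rat) \<Rightarrow> 'p::prime_card padic" where
  "padic_of_seq X = Abs_padic (Collect (padic_rel CARD('p) X))"

definition seq_of_padic :: "'p::prime_card padic \<Rightarrow> nat \<Rightarrow> rat" where
  "seq_of_padic x = (SOME X. X \<in> Rep_padic x)"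

definition cr_padic :: "(nat \<Rightarrow> rat) \<Rightarrow> 'p::prime_card padic \<Rightarrow> bool" where
  "cr_padic X x \<longleftrightarrow> padic_rel CARD('p) X X \<and> padic_of_seq X = x"

lemma Quotient_padic:
  "Quotient (padic_rel CARD('p::prime_card)) (padic_of_seq :: _ \<Rightarrow> 'p padic) seq_of_padic cr_padic"
proof -
  interpret quot_type "padic_rel CARD('p)" "Abs_padic :: _ \<Rightarrow> 'p padic" Rep_padic
    by unfold_locales
       (use Rep_padic Rep_padic_inverse Abs_padic_inverse Rep_padic_inject
          part_equivp_padic_rel[OF prime_card] in blast)+
  have 1: "abs = (padic_of_seq :: _ \<Rightarrow> 'p padic)"
    by (simp add: fun_eq_iff abs_def padic_of_seq_def)
  have 2: "rep = (seq_of_padic :: 'p padic \<Rightarrow> _)"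
    by (simp add: fun_eq_iff rep_def seq_of_padic_def)
  have 3: "(cr_padic :: _ \<Rightarrow> 'p padic \<Rightarrow> _) \<equiv> \<lambda>X x. padic_rel CARD('p) X X \<and> padic_of_seq X = x"
    by (rule eq_reflection) (simp add: fun_eq_iff cr_padic_def)
  from Quotient[unfolded 1 2] 3 show ?thesis
    by (rule Quotient3_to_Quotient)
qed

setup_lifting Quotient_padic

instantiation padic :: (prime_card) field
begin

lift_definition zero_padic :: "'a padic" is "\<lambda>n. 0"
  by (simp add: padic_rel_refl)

lift_definition one_padic :: "'a padic" is "\<lambda>n. 1"
  by (simp add: padic_rel_refl)

lift_definition plus_padic :: "'a padic \<Rightarrow> 'a padic \<Rightarrow> 'a padic" is "\<lambda>X Y n. X n + Y n"
  by (auto simp: padic_rel_def add_diff_add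
           intro: padic_cauchy_add[OF prime_card] padic_null_add[OF prime_card])

lift_definition uminus_padic :: "'a padic \<Rightarrow> 'a padic" is "\<lambda>X n. - X n"
  by (auto simp: padic_rel_def intro: padic_cauchy_minus[OF prime_card]
           dest: padic_null_diff_commute[OF prime_card])

lift_definition times_padic :: "'a padic \<Rightarrow> 'a padic \<Rightarrow> 'a padic" is "\<lambda>X Y n. X n * Y n"
  by (rule padic_rel_mult[OF prime_card])

lift_definition inverse_padic :: "'a padic \<Rightarrow> 'a padic"
  is "\<lambda>X. if padic_null CARD('a) X then (\<lambda>n. 0) else (\<lambda>n. inverse (X n))"
  by (rule padic_rel_inverse[OF prime_card])

definition "x - y = x + - y" for x y :: "'a padic"

definition "x div y = x * inverse y" for x y :: "'a padic"

instance
proof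
  note p = prime_card[where 'a = 'a]
  note [simp] = padic_rel_def padic_cauchy_add[OF p] padic_cauchy_mult[OF p]
    padic_cauchy_minus[OF p] padic_null_const_iff[OF p]
  fix a b c :: "'a padic"
  show "a + b = b + a" by transfer (simp add: ac_simps)
  show "(a + b) + c = a + (b + c)" by transfer (simp add: ac_simps)
  show "0 + a = a" by transfer simp
  show "- a + a = 0" by transfer simp
  show "a - b = a + - b" by (rule minus_padic_def)
  show "(a * b) * c = a * (b * c)" by transfer (simp add: ac_simps)
  show "a * b = b * a" by transfer (simp add: ac_simps)
  show "1 * a = a" by transfer simp
  show "(a + b) * c = a * c + b * c" by transfer (simp add: distrib_right)
  show "(0 :: 'a padic) \<noteq> 1"
    by transfer simp
  show "a \<noteq> 0 \<Longrightarrow> inverse a * a = 1"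
    by transfer (simp add: padic_null_inverse_mult[OF p] padic_cauchy_inverse[OF p])
  show "a div b = a * inverse b" by (rule divide_padic_def)
  show "inverse (0 :: 'a padic) = 0" by transfer simp
qed

end

lemma padic_of_seq_eq_iff:
  assumes "padic_cauchy CARD('p) X" "padic_cauchy CARD('p) Y"
  shows "(padic_of_seq X :: 'p::prime_card padic) = padic_of_seq Y
           \<longleftrightarrow> padic_null CARD('p) (\<lambda>n. X n - Y n)"
  using Quotient_rel[OF Quotient_padic[where 'p = 'p], of X Y] assms
  by (simp add: padic_rel_def)

lemma padic_cases:
  obtains X where "padic_cauchy CARD('p) X" "(x :: 'p::prime_card padic) = padic_of_seq X"
  using Quotient_rep_reflp[OF Quotient_padic, of x] Quotient_abs_rep[OF Quotient_padic, of x]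
    padic_rel_refl by metis

lemma padic_add_seq:
  assumes "padic_cauchy CARD('p) X" "padic_cauchy CARD('p) Y"
  shows "padic_of_seq X + padic_of_seq Y = (padic_of_seq (\<lambda>n. X n + Y n) :: 'p::prime_card padic)"
  using assms by (intro plus_padic.abs_eq) (simp_all add: padic_rel_refl)

lemma padic_minus_seq:
  assumes "padic_cauchy CARD('p) X"
  shows "- padic_of_seq X = (padic_of_seq (\<lambda>n. - X n) :: 'p::prime_card padic)"
  using assms by (intro uminus_padic.abs_eq) (simp_all add: padic_rel_refl)

lemma padic_diff_seq:
  assumes "padic_cauchy CARD('p) X" "padic_cauchy CARD('p) Y"
  shows "padic_of_seq X - padic_of_seq Y = (padic_of_seq (\<lambda>n. X n - Y n) :: 'p::prime_card padic)"
  using assms by (simp add: minus_padic_def padic_minus_seq padic_add_seq padic_cauchy_minus[OF prime_card])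

lemma padic_mult_seq:
  assumes "padic_cauchy CARD('p) X" "padic_cauchy CARD('p) Y"
  shows "padic_of_seq X * padic_of_seq Y = (padic_of_seq (\<lambda>n. X n * Y n) :: 'p::prime_card padic)"
  using assms by (intro times_padic.abs_eq) (simp_all add: padic_rel_refl)

lemma padic_of_nat_seq: "(of_nat n :: 'p::prime_card padic) = padic_of_seq (\<lambda>_. of_nat n)"
  by (induction n) (simp_all add: zero_padic.abs_eq one_padic.abs_eq padic_add_seq)

instance padic :: (prime_card) field_char_0
proof
  show "inj (of_nat :: nat \<Rightarrow> 'a padic)"
    by (rule injI)
       (simp add: padic_of_nat_seq padic_of_seq_eq_iff padic_null_const_iff[OF prime_card])
qed

lemma padic_of_int_seq: "(of_int n :: 'p::prime_card padic) = padic_of_seq (\<lambda>_. of_int n)"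
  by (cases n rule: int_diff_cases) (simp add: padic_of_nat_seq padic_diff_seq)

lemma padic_of_rat_seq: "(of_rat q :: 'p::prime_card padic) = padic_of_seq (\<lambda>_. q)"
proof (cases q)
  case (Fract a b)
  have q: "q = of_int a / of_int b" using Fract by (simp add: Fract_of_int_quotient)
  have b: "(of_int b :: 'p padic) \<noteq> 0" using Fract by simp
  have "padic_of_seq (\<lambda>_. q) * of_int b = (of_int a :: 'p padic)"
    using Fract(2) by (simp add: padic_of_int_seq padic_mult_seq) (simp add: q)
  then have "padic_of_seq (\<lambda>_. q) = (of_int a / of_int b :: 'p padic)"
    using b by (simp add: eq_divide_eq)
  then show ?thesis by (simp add: q of_rat_divide)
qed

text \<open>\<open>padic_abs x\<close> is \<open>\<bar>x\<bar>\<^sub>p\<close>, normalized by \<open>\<bar>p\<bar>\<^sub>p = 1/p\<close>.\<close>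

lift_definition padic_abs :: "'p::prime_card padic \<Rightarrow> real"
  is "\<lambda>X. lim (\<lambda>n. rat_padic_abs CARD('p) (X n))"
  by (rule padic_rel_lim_eq[OF prime_card])

lemma tendsto_padic_abs:
  assumes "padic_cauchy CARD('p) X"
  shows "(\<lambda>n. rat_padic_abs CARD('p) (X n)) \<longlonglongrightarrow> padic_abs (padic_of_seq X :: 'p::prime_card padic)"
proof -
  have "padic_abs (padic_of_seq X :: 'p padic) = lim (\<lambda>n. rat_padic_abs CARD('p) (X n))"
    using assms by (intro padic_abs.abs_eq) (simp add: padic_rel_refl)
  then show ?thesis
    using padic_cauchy_abs_convergent[OF prime_card assms] by (simp add: convergent_LIMSEQ_iff)
qed

lemma padic_abs_of_rat: "padic_abs (of_rat q :: 'p::prime_card padic) = rat_padic_abs CARD('p) q"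
  using LIMSEQ_unique[OF tendsto_padic_abs[of "\<lambda>_. q", where 'p = 'p] tendsto_const]
  by (simp add: padic_of_rat_seq)

lemma padic_abs_p: "padic_abs (of_nat CARD('p) :: 'p::prime_card padic) = 1 / real CARD('p)"
  using padic_abs_of_rat[of "of_nat CARD('p)", where 'p = 'p] rat_padic_abs_p[OF prime_card[where 'a = 'p]]
  by (simp only: of_rat_of_nat_eq)

lemma padic_abs_nonneg: "padic_abs (x :: 'p::prime_card padic) \<ge> 0"
proof -
  obtain X where X: "padic_cauchy CARD('p) X" "x = padic_of_seq X" by (rule padic_cases)
  show ?thesis unfolding X(2) using tendsto_padic_abs[OF X(1)] by (rule LIMSEQ_le_const) auto
qed

lemma padic_abs_eq_0_iff: "padic_abs (x :: 'p::prime_card padic) = 0 \<longleftrightarrow> x = 0"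
proof -
  obtain X where X: "padic_cauchy CARD('p) X" "x = padic_of_seq X" by (rule padic_cases)
  have "x = 0 \<longleftrightarrow> padic_null CARD('p) X"
    using padic_of_seq_eq_iff[OF X(1) padic_cauchy_const[of _ 0]]
    by (simp add: X(2) zero_padic.abs_eq)
  also have "\<dots> \<longleftrightarrow> padic_abs x = 0"
    using tendsto_padic_abs[OF X(1)] LIMSEQ_unique unfolding padic_null_def X(2) by metis
  finally show ?thesis by simp
qed

lemma padic_abs_minus: "padic_abs (- x :: 'p::prime_card padic) = padic_abs x"
proof -
  obtain X where X: "padic_cauchy CARD('p) X" "x = padic_of_seq X" by (rule padic_cases)
  have "(\<lambda>n. rat_padic_abs CARD('p) (- X n)) \<longlonglongrightarrow> padic_abs (- x)"
    using tendsto_padic_abs[OF padic_cauchy_minus[OF prime_card X(1)]]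
    by (simp add: X padic_minus_seq)
  then show ?thesis
    using tendsto_padic_abs[OF X(1)] LIMSEQ_unique
    unfolding X(2) rat_padic_abs_minus[OF prime_card] by blast
qed

lemma padic_abs_mult: "padic_abs (x * y :: 'p::prime_card padic) = padic_abs x * padic_abs y"
proof -
  obtain X where X: "padic_cauchy CARD('p) X" "x = padic_of_seq X" by (rule padic_cases)
  obtain Y where Y: "padic_cauchy CARD('p) Y" "y = padic_of_seq Y" by (rule padic_cases)
  have "(\<lambda>n. rat_padic_abs CARD('p) (X n * Y n)) \<longlonglongrightarrow> padic_abs (x * y)"
    using tendsto_padic_abs[OF padic_cauchy_mult[OF prime_card X(1) Y(1)]]
    by (simp add: X Y padic_mult_seq)
  moreover have "(\<lambda>n. rat_padic_abs CARD('p) (X n * Y n)) \<longlonglongrightarrow> padic_abs x * padic_abs y"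
    unfolding rat_padic_abs_mult[OF prime_card] X(2) Y(2)
    by (intro tendsto_mult tendsto_padic_abs X Y)
  ultimately show ?thesis by (rule LIMSEQ_unique)
qed

lemma padic_abs_ultrametric: "padic_abs (x + y :: 'p::prime_card padic) \<le> max (padic_abs x) (padic_abs y)"
proof -
  obtain X where X: "padic_cauchy CARD('p) X" "x = padic_of_seq X" by (rule padic_cases)
  obtain Y where Y: "padic_cauchy CARD('p) Y" "y = padic_of_seq Y" by (rule padic_cases)
  have 1: "(\<lambda>n. rat_padic_abs CARD('p) (X n + Y n)) \<longlonglongrightarrow> padic_abs (x + y)"
    using tendsto_padic_abs[OF padic_cauchy_add[OF prime_card X(1) Y(1)]]
    by (simp add: X Y padic_add_seq)
  have 2: "(\<lambda>n. max (rat_padic_abs CARD('p) (X n)) (rat_padic_abs CARD('p) (Y n)))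
             \<longlonglongrightarrow> max (padic_abs x) (padic_abs y)"
    unfolding X(2) Y(2) by (intro tendsto_max tendsto_padic_abs X Y)
  show ?thesis
    by (rule LIMSEQ_le[OF 1 2]) (use rat_padic_abs_ultrametric[OF prime_card] in blast)
qed

instantiation padic :: (prime_card) metric_space
begin

definition dist_padic :: "'a padic \<Rightarrow> 'a padic \<Rightarrow> real" where
  "dist_padic x y = padic_abs (x - y)"

definition uniformity_padic :: "('a padic \<times> 'a padic) filter" where
  "uniformity_padic = (INF e\<in>{0<..}. principal {(x, y). dist x y < e})"

definition open_padic :: "'a padic set \<Rightarrow> bool" where
  "open_padic U \<longleftrightarrow> (\<forall>x\<in>U. eventually (\<lambda>(x', y). x' = x \<longrightarrow> y \<in> U) uniformity)"

instance
proof
  fix x y z :: "'a padic"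
  show "dist x y = 0 \<longleftrightarrow> x = y" by (simp add: dist_padic_def padic_abs_eq_0_iff)
  have "padic_abs (x - y) \<le> max (padic_abs (x - z)) (padic_abs (z - y))"
    using padic_abs_ultrametric[of "x - z" "z - y"] by simp
  also have "\<dots> \<le> padic_abs (x - z) + padic_abs (z - y)"
    using padic_abs_nonneg[of "x - z"] padic_abs_nonneg[of "z - y"] by simp
  also have "padic_abs (z - y) = padic_abs (y - z)" using padic_abs_minus[of "z - y"] by simp
  finally show "dist x y \<le> dist x z + dist y z" by (simp add: dist_padic_def)
qed (fact uniformity_padic_def open_padic_def)+

end

lemma of_rat_tendsto_padic:
  assumes "padic_cauchy CARD('p) X"
  shows "(\<lambda>n. of_rat (X n)) \<longlonglongrightarrow> (padic_of_seq X :: 'p::prime_card padic)"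
proof (rule metric_LIMSEQ_I)
  fix e :: real assume e: "e > 0"
  then obtain N where N: "\<And>m n. m \<ge> N \<Longrightarrow> n \<ge> N \<Longrightarrow> rat_padic_abs CARD('p) (X m - X n) < e / 2"
    using assms unfolding padic_cauchy_def by (meson half_gt_zero)
  have "dist (of_rat (X n)) (padic_of_seq X :: 'p padic) < e" if n: "n \<ge> N" for n
  proof -
    have c: "padic_cauchy CARD('p) (\<lambda>m. X n - X m)"
      using padic_cauchy_add[OF prime_card padic_cauchy_const padic_cauchy_minus[OF prime_card assms]]
      by simp
    have "padic_abs (padic_of_seq (\<lambda>m. X n - X m) :: 'p padic) \<le> e / 2"
      by (rule LIMSEQ_le_const2[OF tendsto_padic_abs[OF c]])
         (use N[OF n] in \<open>auto intro!: exI[of _ N] less_imp_le\<close>)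
    then show ?thesis
      using e assms by (simp add: dist_padic_def padic_of_rat_seq padic_diff_seq)
  qed
  then show "\<exists>N. \<forall>n\<ge>N. dist (of_rat (X n)) (padic_of_seq X :: 'p padic) < e" by blast
qed

instance padic :: (prime_card) complete_space
proof
  fix x :: "nat \<Rightarrow> 'a padic" assume x: "Cauchy x"
  have "\<exists>q. dist (x n) (of_rat q) < inverse (real (Suc n))" for n
  proof -
    obtain X where X: "padic_cauchy CARD('a) X" "x n = padic_of_seq X" by (rule padic_cases)
    obtain m where "dist (of_rat (X m)) (x n) < inverse (real (Suc n))"
      using metric_LIMSEQ_D[OF of_rat_tendsto_padic[OF X(1)], of "inverse (real (Suc n))"]
      by (auto simp: X(2))
    then show ?thesis by (metis dist_commute)
  qed
  then obtain q where q: "\<And>n. dist (x n) (of_rat (q n)) < inverse (real (Suc n))" by metis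
  have close: "(\<lambda>n. dist (x n) (of_rat (q n))) \<longlonglongrightarrow> 0"
    by (rule tendsto_sandwich[OF _ _ tendsto_const LIMSEQ_inverse_real_of_nat])
       (use q less_imp_le in \<open>auto intro!: always_eventually\<close>)
  have "padic_cauchy CARD('a) q"
    unfolding padic_cauchy_def
  proof (intro allI impI)
    fix e :: real assume e: "e > 0"
    obtain M where M: "\<And>m n. m \<ge> M \<Longrightarrow> n \<ge> M \<Longrightarrow> dist (x m) (x n) < e / 3"
      using metric_CauchyD[OF x, of "e / 3"] e by auto
    obtain N where N: "\<And>n. n \<ge> N \<Longrightarrow> dist (x n) (of_rat (q n)) < e / 3"
      using metric_LIMSEQ_D[OF close, of "e / 3"] e by auto
    have "rat_padic_abs CARD('a) (q m - q n) < e" if mn: "m \<ge> max M N" "n \<ge> max M N" for m n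
    proof -
      have "dist (of_rat (q m)) (of_rat (q n) :: 'a padic)
          \<le> dist (of_rat (q m)) (x m) + dist (x m) (x n) + dist (x n) (of_rat (q n))"
        using dist_triangle[of "of_rat (q m)" "of_rat (q n)" "x m"]
          dist_triangle[of "x m" "of_rat (q n)" "x n"] by linarith
      also have "\<dots> < e / 3 + e / 3 + e / 3"
        using M[of m n] N[of m] N[of n] mn by (simp add: dist_commute)
      finally show ?thesis by (simp add: dist_padic_def padic_abs_of_rat flip: of_rat_diff)
    qed
    then show "\<exists>N. \<forall>m\<ge>N. \<forall>n\<ge>N. rat_padic_abs CARD('a) (q m - q n) < e" by blast
  qed
  then have "(\<lambda>n. of_rat (q n)) \<longlonglongrightarrow> (padic_of_seq q :: 'a padic)" by (rule of_rat_tendsto_padic)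
  then have lim: "(\<lambda>n. dist (of_rat (q n)) (padic_of_seq q :: 'a padic)) \<longlonglongrightarrow> 0"
    by (subst (asm) tendsto_dist_iff)
  have "(\<lambda>n. dist (x n) (padic_of_seq q)) \<longlonglongrightarrow> 0"
    by (rule tendsto_sandwich[OF _ _ tendsto_const tendsto_add_zero[OF close lim]])
       (auto intro!: always_eventually dist_triangle)
  then have "x \<longlonglongrightarrow> padic_of_seq q"
    by (subst tendsto_dist_iff)
  then show "convergent x" by (auto simp: convergent_def)
qed


section \<open>The dynamical system\<close>

definition E_p :: "'p::prime_card padic set" where
  "E_p = {x. padic_abs (x - 1) < 1}"

definition g_map :: "'p::prime_card padic \<Rightarrow> 'p padic \<Rightarrow> 'p padic \<Rightarrow> 'p padic" where
  "g_map a b u = a * ((b\<^sup>2 * u\<^sup>2 + 1) / (b\<^sup>2 + u\<^sup>2))"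

definition g_fixed_points :: "'p::prime_card padic \<Rightarrow> 'p padic \<Rightarrow> 'p padic set" where
  "g_fixed_points a b = {x. b\<^sup>2 + x\<^sup>2 \<noteq> 0 \<and> g_map a b x = x}"

text \<open>
  \<open>k_map a b\<close> is total because \<open>y / 0 = 0\<close> in Isabelle/HOL. It is only ever used on the
  union \<open>X\<close> of the two balls, which does not contain the pole \<open>- b\<^sup>2\<close>.
\<close>

definition k_map :: "'p::prime_card padic \<Rightarrow> 'p padic \<Rightarrow> 'p padic \<Rightarrow> 'p padic" where
  "k_map a b x = (a * (b\<^sup>2 * x + 1) / (b\<^sup>2 + x))\<^sup>2"

text \<open>
  \<open>iter_preimage X f n\<close> is \<open>f\<^sup>-\<^sup>n(X)\<close> for \<open>f\<close> regarded as a partial map with domain \<open>X\<close>: the guard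
  \<open>x \<in> X\<close> discards the points at which the \<open>n\<close>-th iterate is undefined.
\<close>

primrec iter_preimage :: "'a set \<Rightarrow> ('a \<Rightarrow> 'a) \<Rightarrow> nat \<Rightarrow> 'a set" where
  "iter_preimage X f 0 = X"
| "iter_preimage X f (Suc n) = {x \<in> X. f x \<in> iter_preimage X f n}"

definition julia_set :: "'a set \<Rightarrow> ('a \<Rightarrow> 'a) \<Rightarrow> 'a set" where
  "julia_set X f = (\<Inter>n. iter_preimage X f n)"


section \<open>The symbolic side\<close>

definition shift_space :: "(nat \<Rightarrow> nat) set" where
  "shift_space = UNIV \<rightarrow> {1, 2}"

definition left_shift :: "(nat \<Rightarrow> 'a) \<Rightarrow> nat \<Rightarrow> 'a" where
  "left_shift s = (\<lambda>i. s (Suc i))"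

text \<open>In \<open>tau\<close> and \<open>kappa\<close>, \<open>c j\<close> is the centre of the \<open>j\<close>-th ball, i.e. \<open>x\<^sub>j\<^sup>2\<close>.\<close>

definition tau ::
    "('p::prime_card padic \<Rightarrow> 'p padic) \<Rightarrow> real \<Rightarrow> (nat \<Rightarrow> 'p padic) \<Rightarrow> nat \<Rightarrow> int" where
  "tau f r c j =
     (THE t. \<forall>x \<in> ball (c j) r. \<forall>y \<in> ball (c j) r.
        padic_abs (f x - f y) = real CARD('p) powi t * padic_abs (x - y))"

definition kappa :: "(nat \<Rightarrow> 'p::prime_card padic) \<Rightarrow> nat \<Rightarrow> nat \<Rightarrow> int" where
  "kappa c i j = (THE m. padic_abs (c i - c j) = real CARD('p) powi (- m))"

definition shift_dist ::
    "nat \<Rightarrow> (nat \<Rightarrow> int) \<Rightarrow> (nat \<Rightarrow> nat \<Rightarrow> int) \<Rightarrow> (nat \<Rightarrow> nat) \<Rightarrow> (nat \<Rightarrow> nat) \<Rightarrow> real" where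
  "shift_dist p \<tau> \<kappa> s t =
     (if s = t then 0
      else let n = (LEAST i. s i \<noteq> t i)
           in if n \<noteq> 0 then real p powi (- (\<Sum>i<n. \<tau> (s i)) - \<kappa> (s n) (t n))
              else real p powi (- \<kappa> (s 0) (t 0)))"

end

theory Submission
  imports Defs
begin

text \<open>
  Write \<open>k = f\<^sup>2\<close> with the Moebius map \<open>f u = a (b\<^sup>2 u + 1) / (b\<^sup>2 + u)\<close>, and \<open>c\<close> for one of the two
  fixed points \<open>x\<^sub>1, x\<^sub>2\<close> of \<open>g\<close> outside the unit ball around 1, so that \<open>f (c\<^sup>2) = c\<close>. The whole
  argument rests on one fact: \<open>k\<close> maps each of the two balls of radius \<open>r\<close> bijectively onto the same
  ball of radius 1, multiplying all distances by the constant \<open>1/r\<close>, and the two balls lie in that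
  unit ball at distance exactly \<open>r\<close> from each other.

  This is read off from the fixed point equation. It is a cubic which reduces to
  \<open>(u - 1) (u\<^sup>2 + 1) = 0\<close> in the residue field; hence \<open>x\<^sub>1, x\<^sub>2\<close> are units whose squares are congruent
  to \<open>-1\<close>, and the unit ball in question is the one around \<open>-1\<close>. The equation can be written as
  \<open>(b\<^sup>2 + c\<^sup>2) (c - a b\<^sup>2) = a (1 - b\<^sup>4)\<close>, whose right-hand side has absolute value \<open>r\<close>. At \<open>c = x\<^sub>1, x\<^sub>2\<close>
  the second factor is a unit, so these squares are at distance \<open>r\<close> from the pole \<open>-b\<^sup>2\<close> of \<open>f\<close>. At
  \<open>x\<^sub>0\<close> the first factor is a unit, so \<open>x\<^sub>0\<close> is at distance \<open>r\<close> from \<open>a b\<^sup>2 = x\<^sub>0 + x\<^sub>1 + x\<^sub>2\<close>, whence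
  \<open>\<bar>x\<^sub>1\<^sup>2 - x\<^sub>2\<^sup>2\<bar> = \<bar>x\<^sub>1 + x\<^sub>2\<bar> = r\<close> (lemma \<open>fixed_points_geometry\<close>). The Moebius map \<open>f\<close>, of
  determinant \<open>a (b\<^sup>4 - 1)\<close>, multiplies the distance of two points by the absolute value of its
  determinant over the product of their distances to the pole, here by \<open>r / r\<^sup>2\<close>, and squaring is an
  isometry near a unit because 2 is a unit (lemma \<open>k_map_expanding\<close>). Surjectivity is a square root
  extracted near \<open>c\<close> followed by the inverse of \<open>f\<close> (lemma \<open>k_map_onto\<close>).

  The symbolic part works in any complete metric space. Since the branches are expanding and each is
  onto a set which contains all of them, the points which follow a prescribed sequence of branches
  for \<open>n\<close> steps form a decreasing sequence of nonempty closed sets with diameters tending to 0; thus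
  every sequence is the itinerary of exactly one point. If two itineraries first differ at time \<open>n\<close>,
  the \<open>n\<close>-th iterates lie in different branches, so their distance is known, and dividing by the
  accumulated expansion gives the distance of the points themselves
  (theorem \<open>conjugate_to_full_shift\<close>).
\<close>


section \<open>Full expanding branches and symbolic dynamics\<close>

lemma julia_set_iff: "u \<in> julia_set X f \<longleftrightarrow> (\<forall>n. (f ^^ n) u \<in> X)"
proof -
  have "u \<in> iter_preimage X f n \<longleftrightarrow> (\<forall>i\<le>n. (f ^^ i) u \<in> X)" for n u
  proof (induction n arbitrary: u)
    case (Suc n)
    then show ?case
      by (simp add: All_less_Suc2 less_Suc_eq_le[symmetric] funpow_Suc_right del: funpow.simps)
  qed simp
  then show ?thesis by (auto simp: julia_set_def)
qed

text \<open>
  The setting of the coding theorem: finitely or infinitely many branches \<open>B i\<close>, each blown up by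
  \<open>k\<close> onto all of \<open>D\<close> with its own constant ratio. The distance of two points in different branches
  depends on the branches alone, as happens for disjoint balls of an ultrametric space; this is what
  turns the coding into an isometry and not merely a homeomorphism.
\<close>

locale full_expanding_branches =
  fixes S :: "'i set"
    and B :: "'i \<Rightarrow> 'a::complete_space set"
    and D :: "'a set"
    and k :: "'a \<Rightarrow> 'a"
    and scale :: "'i \<Rightarrow> real"
    and L :: real
    and \<delta> :: "'i \<Rightarrow> 'i \<Rightarrow> real"
  assumes closed_B: "i \<in> S \<Longrightarrow> closed (B i)"
    and B_subset: "i \<in> S \<Longrightarrow> B i \<subseteq> D"
    and onto: "i \<in> S \<Longrightarrow> k ` B i = D"
    and expanding: "\<lbrakk>i \<in> S; u \<in> B i; v \<in> B i\<rbrakk> \<Longrightarrow> dist (k u) (k v) = scale i * dist u v"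
    and scale_ge: "i \<in> S \<Longrightarrow> L \<le> scale i"
    and L_gt_1: "1 < L"
    and disjoint: "\<lbrakk>i \<in> S; j \<in> S; i \<noteq> j\<rbrakk> \<Longrightarrow> B i \<inter> B j = {}"
    and dist_branches: "\<lbrakk>i \<in> S; j \<in> S; i \<noteq> j; u \<in> B i; v \<in> B j\<rbrakk> \<Longrightarrow> dist u v = \<delta> i j"
    and closed_D: "closed D"
    and bounded_D: "bounded D"
    and D_nonempty: "D \<noteq> {}"
begin

lemma scale_pos: "i \<in> S \<Longrightarrow> 0 < scale i"
  using scale_ge L_gt_1 by fastforce

text \<open>
  The points of \<open>D\<close> that visit \<open>B (s 0), \<dots>, B (s (n - 1))\<close> in this order. Peeling off the first symbol
  instead of the last makes every property below an induction with one application of \<open>k\<close>.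
\<close>

primrec cylinder :: "nat \<Rightarrow> (nat \<Rightarrow> 'i) \<Rightarrow> 'a set" where
  "cylinder 0 s = D"
| "cylinder (Suc n) s = {u \<in> B (s 0). k u \<in> cylinder n (left_shift s)}"

lemma left_shift_in: "s \<in> UNIV \<rightarrow> S \<Longrightarrow> left_shift s \<in> UNIV \<rightarrow> S"
  by (auto simp: left_shift_def)

lemma continuous_on_branch:
  assumes "i \<in> S"
  shows "continuous_on (B i) k"
proof (rule continuous_onI)
  fix u and e :: real
  assume u: "u \<in> B i" and e: "0 < e"
  show "\<exists>d>0. \<forall>v\<in>B i. dist v u < d \<longrightarrow> dist (k v) (k u) \<le> e"
  proof (intro exI conjI ballI impI)
    show "0 < e / scale i" using e scale_pos[OF assms] by simp
  next
    fix v assume "v \<in> B i" "dist v u < e / scale i"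
    then show "dist (k v) (k u) \<le> e"
      using expanding[OF assms _ u] scale_pos[OF assms] by (simp add: field_simps)
  qed
qed

lemma closed_cylinder: "s \<in> UNIV \<rightarrow> S \<Longrightarrow> closed (cylinder n s)"
proof (induction n arbitrary: s)
  case 0
  then show ?case by (simp add: closed_D)
next
  case (Suc n)
  have s0: "s 0 \<in> S" using Suc.prems by auto
  have "closed (B (s 0) \<inter> k -` cylinder n (left_shift s))"
    by (intro continuous_closed_preimage continuous_on_branch closed_B s0 Suc.IH
          left_shift_in Suc.prems)
  moreover have "cylinder (Suc n) s = B (s 0) \<inter> k -` cylinder n (left_shift s)" by auto
  ultimately show ?case by simp
qed

lemma cylinder_subset_D: "s \<in> UNIV \<rightarrow> S \<Longrightarrow> cylinder n s \<subseteq> D"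
  using B_subset by (cases n) force+

lemma cylinder_nonempty: "s \<in> UNIV \<rightarrow> S \<Longrightarrow> cylinder n s \<noteq> {}"
proof (induction n arbitrary: s)
  case 0
  then show ?case by (simp add: D_nonempty)
next
  case (Suc n)
  have s0: "s 0 \<in> S" using Suc.prems by auto
  obtain v where v: "v \<in> cylinder n (left_shift s)"
    using Suc.IH[OF left_shift_in[OF Suc.prems]] by blast
  then have "v \<in> k ` B (s 0)"
    using onto[OF s0] cylinder_subset_D[OF left_shift_in[OF Suc.prems]] by blast
  then show ?case using v by auto
qed

lemma cylinder_Suc_subset: "s \<in> UNIV \<rightarrow> S \<Longrightarrow> cylinder (Suc n) s \<subseteq> cylinder n s"
proof (induction n arbitrary: s)
  case 0
  then show ?case using cylinder_subset_D[of s "Suc 0"] by simp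
next
  case (Suc n)
  then show ?case using left_shift_in[of s] by auto
qed

text \<open>
  Each of the first \<open>n\<close> steps stretches distances at least by the factor \<open>L\<close>, and the final images
  still lie in \<open>D\<close>.
\<close>

lemma dist_cylinder:
  assumes "\<And>u v. u \<in> D \<Longrightarrow> v \<in> D \<Longrightarrow> dist u v \<le> R" and "s \<in> UNIV \<rightarrow> S"
    and "u \<in> cylinder n s" "v \<in> cylinder n s"
  shows "dist u v \<le> R / L ^ n"
  using assms(2-)
proof (induction n arbitrary: s u v)
  case 0
  then show ?case using assms(1) by simp
next
  case (Suc n)
  have s0: "s 0 \<in> S" using Suc.prems by auto
  have "L * dist u v \<le> scale (s 0) * dist u v"
    by (intro mult_right_mono scale_ge s0) simp
  also have "\<dots> = dist (k u) (k v)" using Suc.prems s0 expanding by simp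
  also have "\<dots> \<le> R / L ^ n"
    using Suc.prems by (intro Suc.IH[OF left_shift_in[OF Suc.prems(1)]]) auto
  finally show ?case using L_gt_1 by (simp add: field_simps)
qed

lemma mem_cylinders_iff:
  assumes "s \<in> UNIV \<rightarrow> S"
  shows "(\<forall>n. u \<in> cylinder n s) \<longleftrightarrow> (\<forall>n. (k ^^ n) u \<in> B (s n))"
proof -
  have "u \<in> cylinder (Suc n) s \<longleftrightarrow> (\<forall>i\<le>n. (k ^^ i) u \<in> B (s i))" if "s \<in> UNIV \<rightarrow> S" for n s u
    using that
  proof (induction n arbitrary: s u)
    case 0
    then show ?case using onto[of "s 0"] by auto
  next
    case (Suc n)
    have "u \<in> cylinder (Suc (Suc n)) s
        \<longleftrightarrow> u \<in> B (s 0) \<and> (\<forall>i\<le>n. (k ^^ i) (k u) \<in> B (left_shift s i))"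
      using Suc.IH[OF left_shift_in[OF Suc.prems], of "k u"]
      by (subst cylinder.simps) blast
    also have "\<dots> \<longleftrightarrow> (\<forall>i\<le>Suc n. (k ^^ i) u \<in> B (s i))"
      by (simp add: left_shift_def All_less_Suc2 less_Suc_eq_le[symmetric] funpow_Suc_right del: funpow.simps)
    finally show ?case .
  qed
  note * = this[OF assms]
  have "(\<forall>n. u \<in> cylinder n s) \<longleftrightarrow> (\<forall>n. u \<in> cylinder (Suc n) s)"
    using cylinder_Suc_subset[OF assms] by blast
  also have "\<dots> \<longleftrightarrow> (\<forall>n. (k ^^ n) u \<in> B (s n))" unfolding * by blast
  finally show ?thesis .
qed

text \<open>
  Cantor's intersection theorem for the cylinders: completeness gives existence, the shrinking
  diameters give uniqueness.
\<close>

lemma ex1_point_with_itinerary: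
  assumes s: "s \<in> UNIV \<rightarrow> S"
  shows "\<exists>!u. \<forall>n. (k ^^ n) u \<in> B (s n)"
proof -
  obtain R where R: "\<And>u v. u \<in> D \<Longrightarrow> v \<in> D \<Longrightarrow> dist u v \<le> R"
    using bounded_D unfolding bounded_two_points by blast
  have small: "\<exists>n. \<forall>u\<in>cylinder n s. \<forall>v\<in>cylinder n s. dist u v < e" if e: "e > 0" for e
  proof -
    have "(\<lambda>n. R / L ^ n) \<longlonglongrightarrow> 0"
      using tendsto_mult_right_zero[OF LIMSEQ_inverse_realpow_zero[OF L_gt_1], of R]
      by (simp add: divide_inverse)
    then obtain n where "R / L ^ n < e"
      using order_tendstoD(2)[OF _ e] by (metis eventually_sequentially order_refl)
    then show ?thesis using dist_cylinder[OF R s] by (meson le_less_trans)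
  qed
  have "antimono (\<lambda>n. cylinder n s)"
    using cylinder_Suc_subset[OF s] by (rule decseq_SucI)
  then obtain u where u: "\<And>n. u \<in> cylinder n s"
    using decreasing_closed_nest[of "\<lambda>n. cylinder n s"] closed_cylinder[OF s]
      cylinder_nonempty[OF s] small by (metis antimonoD)
  show ?thesis
    unfolding mem_cylinders_iff[OF s, symmetric]
  proof (rule ex1I)
    show "\<forall>n. u \<in> cylinder n s" using u by blast
  next
    fix v assume v: "\<forall>n. v \<in> cylinder n s"
    show "v = u"
    proof (rule ccontr)
      assume "v \<noteq> u"
      then show False using small[of "dist v u"] u v by fastforce
    qed
  qed
qed

lemma dist_same_symbols:
  assumes "\<And>i. i < n \<Longrightarrow> s i \<in> S \<and> (k ^^ i) u \<in> B (s i) \<and> (k ^^ i) v \<in> B (s i)"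
  shows "dist ((k ^^ n) u) ((k ^^ n) v) = (\<Prod>i<n. scale (s i)) * dist u v"
  using assms
proof (induction n)
  case (Suc n)
  then show ?case using expanding[of "s n" "(k ^^ n) u" "(k ^^ n) v"] by simp
qed simp

definition itinerary :: "'a \<Rightarrow> nat \<Rightarrow> 'i" where
  "itinerary u n = (THE i. i \<in> S \<and> (k ^^ n) u \<in> B i)"

text \<open>
  The distance formula is stated for any \<open>n\<close> at which the itineraries differ for the first time; it
  describes the metric on the shift space that makes the coding isometric.
\<close>

theorem conjugate_to_full_shift:
  defines "J \<equiv> julia_set (\<Union>i\<in>S. B i) k"
  shows "bij_betw itinerary J (UNIV \<rightarrow> S)"
    and "\<forall>u\<in>J. itinerary (k u) = left_shift (itinerary u)"
    and "\<forall>u\<in>J. \<forall>v\<in>J. \<forall>n. (\<forall>i<n. itinerary u i = itinerary v i) \<longrightarrow> itinerary u n \<noteq> itinerary v n \<longrightarrow>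
           dist u v = \<delta> (itinerary u n) (itinerary v n) / (\<Prod>i<n. scale (itinerary u i))"
proof -
  have unique: "itinerary u n = i" if "i \<in> S" "(k ^^ n) u \<in> B i" for u n i
    unfolding itinerary_def using that disjoint by (intro the_equality) blast+
  have it: "itinerary u n \<in> S" "(k ^^ n) u \<in> B (itinerary u n)" if "u \<in> J" for u n
    using that unique unfolding J_def julia_set_iff by (metis UN_iff)+
  have it_Pi: "itinerary u \<in> UNIV \<rightarrow> S" if "u \<in> J" for u using it[OF that] by auto
  show "bij_betw itinerary J (UNIV \<rightarrow> S)"
  proof (rule bij_betwI')
    fix u v assume uv: "u \<in> J" "v \<in> J"
    then show "itinerary u = itinerary v \<longleftrightarrow> u = v"
      using ex1_point_with_itinerary[OF it_Pi[OF uv(1)]] it by metis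
  next
    fix s :: "nat \<Rightarrow> 'i"
    assume s: "s \<in> UNIV \<rightarrow> S"
    then obtain u where u: "\<And>n. (k ^^ n) u \<in> B (s n)"
      using ex1_point_with_itinerary by blast
    have "u \<in> J" using u s unfolding J_def julia_set_iff by blast
    moreover have "s = itinerary u"
    proof
      fix n
      have "s n \<in> S" using s by auto
      then show "s n = itinerary u n" using unique[OF _ u] by simp
    qed
    ultimately show "\<exists>u\<in>J. s = itinerary u" by blast
  qed (rule it_Pi)
  show "\<forall>u\<in>J. itinerary (k u) = left_shift (itinerary u)"
    by (simp add: fun_eq_iff itinerary_def left_shift_def funpow_Suc_right del: funpow.simps)
  show "\<forall>u\<in>J. \<forall>v\<in>J. \<forall>n. (\<forall>i<n. itinerary u i = itinerary v i) \<longrightarrow> itinerary u n \<noteq> itinerary v n \<longrightarrow>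
           dist u v = \<delta> (itinerary u n) (itinerary v n) / (\<Prod>i<n. scale (itinerary u i))"
  proof (intro ballI allI impI)
    fix u v n
    assume u: "u \<in> J" and v: "v \<in> J" and eq: "\<forall>i<n. itinerary u i = itinerary v i"
      and ne: "itinerary u n \<noteq> itinerary v n"
    have "\<delta> (itinerary u n) (itinerary v n) = dist ((k ^^ n) u) ((k ^^ n) v)"
      using dist_branches ne it[OF u] it[OF v] by metis
    also have "\<dots> = (\<Prod>i<n. scale (itinerary u i)) * dist u v"
      using it[OF u] it[OF v] eq by (intro dist_same_symbols) metis
    finally have "\<delta> (itinerary u n) (itinerary v n) = (\<Prod>i<n. scale (itinerary u i)) * dist u v" .
    moreover have "(\<Prod>i<n. scale (itinerary u i)) > 0"
      using scale_pos it[OF u] by (intro prod_pos) blast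
    ultimately show "dist u v = \<delta> (itinerary u n) (itinerary v n) / (\<Prod>i<n. scale (itinerary u i))"
      by (metis less_irrefl nonzero_mult_div_cancel_left)
  qed
qed

end


section \<open>Ultrametric geometry of \<open>\<rat>\<^sub>p\<close>\<close>

lemma padic_abs_0 [simp]: "padic_abs (0 :: 'p::prime_card padic) = 0"
  by (simp add: padic_abs_eq_0_iff)

lemma padic_abs_1 [simp]: "padic_abs (1 :: 'p::prime_card padic) = 1"
  using padic_abs_of_rat[of 1, where 'p = 'p] rat_padic_abs_1[OF prime_card[where 'a = 'p]] by simp

lemma padic_abs_inverse: "padic_abs (inverse x :: 'p::prime_card padic) = inverse (padic_abs x)"
proof (cases "x = 0")
  case False
  then have "padic_abs x * padic_abs (inverse x) = 1" by (simp flip: padic_abs_mult)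
  then show ?thesis by (metis inverse_unique)
qed simp

lemma padic_abs_divide: "padic_abs (x / y :: 'p::prime_card padic) = padic_abs x / padic_abs y"
  by (simp add: divide_inverse padic_abs_mult padic_abs_inverse)

lemma padic_abs_power: "padic_abs (x ^ n :: 'p::prime_card padic) = padic_abs x ^ n"
  by (induction n) (simp_all add: padic_abs_mult)

lemma padic_abs_minus_commute: "padic_abs (x - y :: 'p::prime_card padic) = padic_abs (y - x)"
  using padic_abs_minus[of "x - y"] by simp

lemma padic_abs_diff_le: "padic_abs (x - y :: 'p::prime_card padic) \<le> max (padic_abs x) (padic_abs y)"
  using padic_abs_ultrametric[of x "- y"] by (simp add: padic_abs_minus)

lemma padic_abs_add_less:
  "padic_abs x < e \<Longrightarrow> padic_abs y < e \<Longrightarrow> padic_abs (x + y :: 'p::prime_card padic) < e"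
  using padic_abs_ultrametric[of x y] by simp

lemma padic_abs_diff_less:
  "padic_abs x < e \<Longrightarrow> padic_abs y < e \<Longrightarrow> padic_abs (x - y :: 'p::prime_card padic) < e"
  using padic_abs_diff_le[of x y] by simp

text \<open>
  The isosceles triangle principle: a perturbation smaller than \<open>y\<close> does not change the absolute value.
\<close>

lemma padic_abs_eq_of_close:
  assumes "padic_abs (x - y :: 'p::prime_card padic) < padic_abs y"
  shows "padic_abs x = padic_abs y"
  using padic_abs_ultrametric[of "x - y" y] padic_abs_diff_le[of x "x - y"] assms
  by simp

lemma padic_abs_mult_less_1:
  assumes "padic_abs x < 1" "padic_abs (y :: 'p::prime_card padic) \<le> 1"
  shows "padic_abs (y * x) < 1"
proof -
  have "padic_abs x * padic_abs y \<le> padic_abs x * 1"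
    using assms(2) padic_abs_nonneg by (rule mult_left_mono)
  then show "padic_abs (y * x) < 1"
    using assms(1) by (simp add: padic_abs_mult mult.commute)
qed

lemma closed_padic_ball: "closed (ball (c :: 'p::prime_card padic) e)"
proof (cases "e > 0")
  case True
  have "ball x e \<subseteq> - ball c e" if "x \<in> - ball c e" for x
  proof
    fix y assume "y \<in> ball x e"
    then show "y \<in> - ball c e"
      using that padic_abs_ultrametric[of "c - y" "y - x"]
      by (auto simp: dist_padic_def padic_abs_minus_commute[of x y])
  qed
  then have "open (- ball c e)"
    unfolding open_contains_ball using True by blast
  then show ?thesis by (simp add: closed_def)
qed (simp add: ball_empty)

lemma padic_ball_eqI:
  assumes "padic_abs (c - c' :: 'p::prime_card padic) < e"
  shows "ball c e = ball c' e"
  using assms padic_abs_add_less[of "c - c'" e "c' - _"] padic_abs_add_less[of "c' - c" e "c - _"]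
  by (fastforce simp: dist_padic_def padic_abs_minus_commute[of c' c])

lemma dist_points_of_padic_balls:
  assumes "u \<in> ball (c :: 'p::prime_card padic) e" "v \<in> ball c' e" "e \<le> padic_abs (c - c')"
  shows "dist u v = padic_abs (c - c')"
proof -
  have "padic_abs ((u - c) - (v - c')) < e"
    using assms(1,2) padic_abs_diff_less[of "u - c" e "v - c'"]
    by (simp add: dist_padic_def padic_abs_minus_commute)
  then show ?thesis
    unfolding dist_padic_def using assms(3) by (intro padic_abs_eq_of_close) (simp add: algebra_simps)
qed

lemma padic_abs_2:
  assumes "CARD('p::prime_card) \<ge> 3"
  shows "padic_abs (2 :: 'p padic) = 1"
proof -
  have "\<not> int CARD('p) dvd 2" using assms zdvd_imp_le[of "int CARD('p)" 2] by linarith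
  then have "rat_padic_abs CARD('p) 2 = 1"
    using rat_padic_abs_divide[OF prime_card[where 'a = 'p], of 2 1]
    by (simp add: not_dvd_imp_multiplicity_0)
  then show ?thesis using padic_abs_of_rat[of 2, where 'p = 'p] by simp
qed

text \<open>
  The value group is discrete: a nonzero \<open>p\<close>-adic number has the same absolute value as every
  sufficiently close rational.
\<close>

lemma padic_abs_eq_powi:
  assumes "(x :: 'p::prime_card padic) \<noteq> 0"
  obtains m :: int where "padic_abs x = real CARD('p) powi (- m)"
proof -
  obtain X where X: "padic_cauchy CARD('p) X" "x = padic_of_seq X" by (rule padic_cases)
  have pos: "padic_abs x > 0" using assms padic_abs_nonneg[of x] padic_abs_eq_0_iff[of x] by linarith
  obtain n where n: "dist (of_rat (X n)) x < padic_abs x"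
    using metric_LIMSEQ_D[OF of_rat_tendsto_padic[OF X(1)] pos] unfolding X(2) by blast
  have eq: "padic_abs x = rat_padic_abs CARD('p) (X n)"
    using padic_abs_eq_of_close n by (metis dist_padic_def padic_abs_of_rat)
  with pos have "X n \<noteq> 0" by auto
  with eq that show thesis
    unfolding rat_padic_abs_def
    by (metis (no_types, lifting) minus_diff_eq)
qed

text \<open>
  Hensel's lemma for \<open>z\<^sup>2 = y\<close>. The simplified Newton iteration, with derivative frozen at the
  approximate root \<open>c\<close>, is a contraction of the closed ball of radius \<open>\<rho> = \<bar>y - c\<^sup>2\<bar>\<close> around \<open>c\<close> with
  ratio \<open>\<rho>\<close>, since \<open>T z - T w = - ((z - c) + (w - c)) (z - w) / (2 c)\<close> and \<open>2 c\<close> is a unit.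
\<close>

lemma padic_sqrt_near_unit:
  fixes c y :: "'p::prime_card padic"
  assumes two: "padic_abs (2 :: 'p padic) = 1" and c: "padic_abs c = 1"
    and y: "padic_abs (y - c\<^sup>2) < 1"
  obtains z where "z\<^sup>2 = y" "padic_abs (z - c) < 1"
proof -
  define \<rho> where "\<rho> = padic_abs (y - c\<^sup>2)"
  define T where "T z = z - (z\<^sup>2 - y) / (2 * c)" for z
  have c0: "c \<noteq> 0" using c by auto
  have two_c: "padic_abs (2 * c) = 1" by (simp add: padic_abs_mult two c)
  have T_diff: "padic_abs (T z - T w) \<le> \<rho> * padic_abs (z - w)"
    if "padic_abs (z - c) \<le> \<rho>" "padic_abs (w - c) \<le> \<rho>" for z w
  proof -
    have "T z - T w = - (((z - c) + (w - c)) * (z - w)) / (2 * c)"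
      using c0 by (simp add: T_def field_simps power2_eq_square)
    then have "padic_abs (T z - T w) = padic_abs ((z - c) + (w - c)) * padic_abs (z - w)"
      by (simp only: padic_abs_divide padic_abs_minus padic_abs_mult[of "_ + _"] two_c div_by_1)
    moreover have "padic_abs ((z - c) + (w - c)) \<le> \<rho>"
      using padic_abs_ultrametric[of "z - c" "w - c"] that by simp
    ultimately show ?thesis
      using padic_abs_nonneg[of "z - w"] by (simp only: mult_right_mono)
  qed
  have rho: "0 \<le> \<rho>" "\<rho> < 1" using y padic_abs_nonneg by (auto simp: \<rho>_def)
  have Tc: "padic_abs (T c - c) = \<rho>"
  proof -
    have "T c - c = (y - c\<^sup>2) / (2 * c)" by (simp add: T_def diff_divide_distrib)
    then show ?thesis by (simp only: padic_abs_divide two_c div_by_1 \<rho>_def)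
  qed
  have "\<exists>!z\<in>cball c \<rho>. T z = z"
  proof (rule Banach_fix[where c = \<rho>])
    show "complete (cball c \<rho>)" by (simp add: complete_eq_closed)
    show "cball c \<rho> \<noteq> {}" using rho by simp
    show "T ` cball c \<rho> \<subseteq> cball c \<rho>"
    proof clarsimp
      fix z assume "dist c z \<le> \<rho>"
      then have z: "padic_abs (z - c) \<le> \<rho>" by (simp add: dist_padic_def padic_abs_minus_commute)
      have "padic_abs (T z - T c) \<le> \<rho> * padic_abs (z - c)" using T_diff[OF z] rho by simp
      also have "\<dots> \<le> 1 * \<rho>" using z rho padic_abs_nonneg by (intro mult_mono) auto
      finally have "padic_abs (T z - c) \<le> \<rho>"
        using padic_abs_ultrametric[of "T z - T c" "T c - c"] Tc by simp
      then show "dist c (T z) \<le> \<rho>" by (simp add: dist_padic_def padic_abs_minus_commute)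
    qed
    show "dist (T z) (T w) \<le> \<rho> * dist z w" if "z \<in> cball c \<rho>" "w \<in> cball c \<rho>" for z w
      using T_diff[of z w] that by (simp add: dist_padic_def padic_abs_minus_commute)
  qed (use rho in auto)
  then obtain z where z: "dist c z \<le> \<rho>" "T z = z" by auto
  have "z\<^sup>2 = y" using z(2) c0 by (simp add: T_def)
  moreover have "padic_abs (z - c) < 1"
    using z(1) rho by (simp add: dist_padic_def padic_abs_minus_commute)
  ultimately show thesis by (rule that)
qed

lemma padic_abs_eq_1_of_mult:
  assumes "padic_abs (x * y :: 'p::prime_card padic) = 1" "padic_abs x \<le> 1" "padic_abs y \<le> 1"
  shows "padic_abs x = 1"
  using assms mult_left_mono[of "padic_abs y" 1 "padic_abs x"] padic_abs_nonneg[of x]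
  by (simp add: padic_abs_mult)

lemma padic_abs_add_1:
  assumes "padic_abs (2 :: 'p::prime_card padic) = 1" "padic_abs (x - 1 :: 'p padic) < 1"
  shows "padic_abs (x + 1) = 1"
  using padic_abs_eq_of_close[of "x + 1" 2] assms by (simp add: algebra_simps)


section \<open>Algebra of the map and its fixed point equation\<close>

text \<open>
  The factor \<open>a (b\<^sup>4 - 1)\<close> is the determinant both of the Moebius map and of its inverse
  \<open>z \<mapsto> (z b\<^sup>2 - a) / (a b\<^sup>2 - z)\<close>. Its absolute value fixes all the scaling ratios below.
\<close>

lemma moebius_diff:
  fixes a b w z :: "'a::field_char_0"
  assumes "b\<^sup>2 + w \<noteq> 0" "b\<^sup>2 + z \<noteq> 0"
  shows "a * (b\<^sup>2 * w + 1) / (b\<^sup>2 + w) - a * (b\<^sup>2 * z + 1) / (b\<^sup>2 + z)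
    = a * (b ^ 4 - 1) * (w - z) / ((b\<^sup>2 + w) * (b\<^sup>2 + z))"
  using assms by (simp add: divide_simps) Groebner_Basis.algebra

lemma moebius_inverse_diff:
  fixes a b c z :: "'a::field_char_0"
  assumes nz: "a * b\<^sup>2 - z \<noteq> 0" "a * b\<^sup>2 - c \<noteq> 0"
  shows "(z * b\<^sup>2 - a) / (a * b\<^sup>2 - z) - (c * b\<^sup>2 - a) / (a * b\<^sup>2 - c)
    = a * (b ^ 4 - 1) * (z - c) / ((a * b\<^sup>2 - z) * (a * b\<^sup>2 - c))"
  unfolding diff_frac_eq[OF nz] by (rule arg_cong[where f = "\<lambda>t. t / _"]) Groebner_Basis.algebra

lemma moebius_of_inverse:
  fixes a b z :: "'a::field_char_0"
  assumes nz: "a * b\<^sup>2 - z \<noteq> 0" and "a \<noteq> 0" "b ^ 4 - 1 \<noteq> 0"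
  defines "u \<equiv> (z * b\<^sup>2 - a) / (a * b\<^sup>2 - z)"
  shows "a * (b\<^sup>2 * u + 1) / (b\<^sup>2 + u) = z"
proof -
  have "b\<^sup>2 + u = a * (b ^ 4 - 1) / (a * b\<^sup>2 - z)"
    unfolding u_def add_num_frac[OF nz] by (rule arg_cong[where f = "\<lambda>t. t / _"]) Groebner_Basis.algebra
  moreover have "b\<^sup>2 * u + 1 = z * (b ^ 4 - 1) / (a * b\<^sup>2 - z)"
    using nz unfolding u_def by (simp add: field_simps)
  ultimately show ?thesis using assms by simp
qed

lemma fixed_point_square:
  fixes a b c :: "'a::field_char_0"
  assumes "c * (b\<^sup>2 + c\<^sup>2) = a * (b\<^sup>2 * c\<^sup>2 + 1)" "a * b\<^sup>2 - c \<noteq> 0"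
  shows "c\<^sup>2 = (c * b\<^sup>2 - a) / (a * b\<^sup>2 - c)"
proof -
  have "c\<^sup>2 * (a * b\<^sup>2 - c) = c * b\<^sup>2 - a" using assms(1) by Groebner_Basis.algebra
  then show ?thesis using assms(2) by (simp add: eq_divide_eq)
qed

text \<open>
  The fixed point equation in a form that relates the distance from \<open>c\<^sup>2\<close> to the pole \<open>-b\<^sup>2\<close> to the
  distance from \<open>c\<close> to the value \<open>a b\<^sup>2\<close> at infinity: their product is known.
\<close>

lemma fixed_equation_factored:
  fixes a b c :: "'a::field_char_0"
  assumes "c * (b\<^sup>2 + c\<^sup>2) = a * (b\<^sup>2 * c\<^sup>2 + 1)"
  shows "(b\<^sup>2 + c\<^sup>2) * (c - a * b\<^sup>2) = - (a * (b ^ 4 - 1))"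
  using assms by Groebner_Basis.algebra

text \<open>
  Vieta's formulas for the cubic \<open>u\<^sup>3 - a b\<^sup>2 u\<^sup>2 + b\<^sup>2 u - a\<close>, obtained by dividing out differences of
  roots.
\<close>

lemma fixed_points_vieta:
  fixes a b x0 x1 x2 :: "'a::field_char_0"
  assumes "x0 * (b\<^sup>2 + x0\<^sup>2) = a * (b\<^sup>2 * x0\<^sup>2 + 1)"
    and "x1 * (b\<^sup>2 + x1\<^sup>2) = a * (b\<^sup>2 * x1\<^sup>2 + 1)"
    and "x2 * (b\<^sup>2 + x2\<^sup>2) = a * (b\<^sup>2 * x2\<^sup>2 + 1)"
    and "x0 \<noteq> x1" "x0 \<noteq> x2" "x1 \<noteq> x2"
  shows "x1 + x2 = a * b\<^sup>2 - x0" "x1 * x2 = b\<^sup>2 - x0 * (x1 + x2)"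
proof -
  have q: "x0\<^sup>2 + x0 * y + y\<^sup>2 - a * b\<^sup>2 * (x0 + y) + b\<^sup>2 = 0"
    if "y * (b\<^sup>2 + y\<^sup>2) = a * (b\<^sup>2 * y\<^sup>2 + 1)" "x0 \<noteq> y" for y
  proof -
    have "(x0 - y) * (x0\<^sup>2 + x0 * y + y\<^sup>2 - a * b\<^sup>2 * (x0 + y) + b\<^sup>2) = 0"
      using that(1) assms(1) by Groebner_Basis.algebra
    then show ?thesis using that(2) by simp
  qed
  note q1 = q[OF assms(2,4)] and q2 = q[OF assms(3,5)]
  have "(x1 - x2) * (x0 + x1 + x2 - a * b\<^sup>2) = 0" using q1 q2 by Groebner_Basis.algebra
  then have "x0 + x1 + x2 - a * b\<^sup>2 = 0" using assms(6) by simp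
  then show 1: "x1 + x2 = a * b\<^sup>2 - x0" by (simp add: algebra_simps)
  show "x1 * x2 = b\<^sup>2 - x0 * (x1 + x2)" using 1 q1 by Groebner_Basis.algebra
qed

section \<open>The branches of the map\<close>

text \<open>
  By the isosceles principle all points of the ball have the same distance \<open>r\<close> to the pole, so the
  Moebius map has the constant ratio \<open>r / r\<^sup>2\<close> there. Its values stay within distance less than 1 of
  the unit \<open>c\<close>; the sum of two such values is congruent to the unit \<open>2 c\<close>, so squaring preserves
  their distance.
\<close>

lemma k_map_expanding:
  fixes a b c :: "'p::prime_card padic"
  assumes two: "padic_abs (2 :: 'p padic) = 1" and a: "padic_abs a = 1"
    and r: "padic_abs (b ^ 4 - 1) = r" "0 < r"
    and fixed: "c * (b\<^sup>2 + c\<^sup>2) = a * (b\<^sup>2 * c\<^sup>2 + 1)" and c: "padic_abs c = 1"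
    and pole: "padic_abs (b\<^sup>2 + c\<^sup>2) = r"
    and u: "padic_abs (u - c\<^sup>2) < r" and v: "padic_abs (v - c\<^sup>2) < r"
  shows "padic_abs (k_map a b u - k_map a b v) = padic_abs (u - v) / r"
proof -
  define f where "f u = a * (b\<^sup>2 * u + 1) / (b\<^sup>2 + u)" for u
  have den: "padic_abs (b\<^sup>2 + w) = r" if "padic_abs (w - c\<^sup>2) < r" for w
    using padic_abs_eq_of_close[of "b\<^sup>2 + w" "b\<^sup>2 + c\<^sup>2"] that pole by simp
  have f_diff: "padic_abs (f w - f z) = padic_abs (w - z) / r"
    if "padic_abs (w - c\<^sup>2) < r" "padic_abs (z - c\<^sup>2) < r" for w z
  proof -
    have "b\<^sup>2 + w \<noteq> 0" "b\<^sup>2 + z \<noteq> 0" using den that r by fastforce+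
    then have "f w - f z = a * (b ^ 4 - 1) * (w - z) / ((b\<^sup>2 + w) * (b\<^sup>2 + z))"
      unfolding f_def by (rule moebius_diff)
    then have "padic_abs (f w - f z) = r * padic_abs (w - z) / (r * r)"
      by (simp only: padic_abs_divide padic_abs_mult den[OF that(1)] den[OF that(2)] a r(1) mult_1_left)
    then show ?thesis using r by simp
  qed
  have c_ball: "padic_abs (c\<^sup>2 - c\<^sup>2) < r" using r by simp
  have "b\<^sup>2 + c\<^sup>2 \<noteq> 0" using pole r by fastforce
  then have fc: "f (c\<^sup>2) = c" using fixed by (simp add: f_def field_simps)
  have near: "padic_abs (f w - c) < 1" if "padic_abs (w - c\<^sup>2) < r" for w
    using f_diff[OF that c_ball] that r by (simp add: fc)
  have "padic_abs ((f u + f v) - 2 * c) < padic_abs (2 * c)"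
    using padic_abs_add_less[OF near[OF u] near[OF v]]
    by (simp add: padic_abs_mult two c algebra_simps)
  then have "padic_abs (f u + f v) = 1"
    using padic_abs_eq_of_close by (fastforce simp: padic_abs_mult two c)
  moreover have "k_map a b u - k_map a b v = (f u - f v) * (f u + f v)"
    by (simp add: k_map_def f_def power2_eq_square algebra_simps)
  ultimately show ?thesis using f_diff[OF u v] by (simp add: padic_abs_mult)
qed

text \<open>
  The preimage is explicit: take the square root \<open>z\<close> of \<open>y\<close> near \<open>c\<close> and apply the inverse Moebius
  map, which sends \<open>c\<close> to \<open>c\<^sup>2\<close> and contracts by the factor \<open>r\<close> around \<open>c\<close>.
\<close>

lemma k_map_onto:
  fixes a b c :: "'p::prime_card padic"
  assumes two: "padic_abs (2 :: 'p padic) = 1" and a: "padic_abs a = 1"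
    and r: "padic_abs (b ^ 4 - 1) = r" "0 < r"
    and fixed: "c * (b\<^sup>2 + c\<^sup>2) = a * (b\<^sup>2 * c\<^sup>2 + 1)" and c: "padic_abs c = 1"
    and pole: "padic_abs (c - a * b\<^sup>2) = 1"
    and y: "padic_abs (y - c\<^sup>2) < 1"
  obtains u where "padic_abs (u - c\<^sup>2) < r" "k_map a b u = y"
proof -
  obtain z where z: "z\<^sup>2 = y" "padic_abs (z - c) < 1"
    using padic_sqrt_near_unit[OF two c y] .
  have "padic_abs (z - a * b\<^sup>2) = 1"
    using padic_abs_eq_of_close[of "z - a * b\<^sup>2" "c - a * b\<^sup>2"] z pole by simp
  then have den: "padic_abs (a * b\<^sup>2 - z) = 1" "padic_abs (a * b\<^sup>2 - c) = 1"
    using pole by (simp_all add: padic_abs_minus_commute)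
  then have nz: "a * b\<^sup>2 - z \<noteq> 0" "a * b\<^sup>2 - c \<noteq> 0" by fastforce+
  have b4: "b ^ 4 - 1 \<noteq> 0" using r by fastforce
  have a0: "a \<noteq> 0" using a by auto
  define u where "u = (z * b\<^sup>2 - a) / (a * b\<^sup>2 - z)"
  have "u - c\<^sup>2 = a * (b ^ 4 - 1) * (z - c) / ((a * b\<^sup>2 - z) * (a * b\<^sup>2 - c))"
    using moebius_inverse_diff[OF nz] fixed_point_square[OF fixed nz(2)] by (simp add: u_def)
  then have "padic_abs (u - c\<^sup>2) = r * padic_abs (z - c)"
    by (simp only: padic_abs_divide padic_abs_mult den a r(1) mult_1_left div_by_1)
  then have "padic_abs (u - c\<^sup>2) < r" using z(2) r by simp
  moreover have "k_map a b u = y"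
    using moebius_of_inverse[OF nz(1) a0 b4] by (simp add: k_map_def u_def z)
  ultimately show thesis by (rule that)
qed

lemma k_map_image_ball:
  fixes a b c :: "'p::prime_card padic"
  assumes two: "padic_abs (2 :: 'p padic) = 1" and a: "padic_abs a = 1"
    and r: "padic_abs (b ^ 4 - 1) = r" "0 < r"
    and fixed: "c * (b\<^sup>2 + c\<^sup>2) = a * (b\<^sup>2 * c\<^sup>2 + 1)" and c: "padic_abs c = 1"
    and pole: "padic_abs (b\<^sup>2 + c\<^sup>2) = r" "padic_abs (c - a * b\<^sup>2) = 1"
  shows "k_map a b ` ball (c\<^sup>2) r = ball (c\<^sup>2) 1"
proof -
  have "b\<^sup>2 + c\<^sup>2 \<noteq> 0" using pole r by fastforce
  then have "a * (b\<^sup>2 * c\<^sup>2 + 1) / (b\<^sup>2 + c\<^sup>2) = c"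
    using fixed by (simp add: divide_eq_eq)
  then have kc: "k_map a b (c\<^sup>2) = c\<^sup>2" by (simp add: k_map_def)
  have "padic_abs (k_map a b u - c\<^sup>2) < 1" if "padic_abs (u - c\<^sup>2) < r" for u
    using k_map_expanding[OF two a r fixed c pole(1) that, of "c\<^sup>2"] r that by (simp add: kc)
  moreover have "\<exists>u. padic_abs (u - c\<^sup>2) < r \<and> k_map a b u = y" if "padic_abs (y - c\<^sup>2) < 1" for y
    using k_map_onto[OF two a r fixed c pole(2) that] by blast
  ultimately show ?thesis
    by (force simp: dist_padic_def padic_abs_minus_commute[of "c\<^sup>2"] image_iff)
qed


section \<open>Location of the fixed points\<close>

lemma g_fixed_points_iff:
  "u \<in> g_fixed_points a b \<longleftrightarrow> b\<^sup>2 + u\<^sup>2 \<noteq> 0 \<and> u * (b\<^sup>2 + u\<^sup>2) = a * (b\<^sup>2 * u\<^sup>2 + 1)"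
  by (auto simp: g_fixed_points_def g_map_def field_simps)

text \<open>
  The two roots that reduce to the square roots of \<open>-1\<close> are recognised by their sum and product,
  through \<open>u\<^sup>2 = u (u + v) - u v\<close>: this identity first bounds \<open>u\<close> by 1 and then shows
  that \<open>u\<^sup>2\<close> is congruent to \<open>-1\<close>.
\<close>

lemma small_sum_unit_product:
  fixes u v :: "'p::prime_card padic"
  assumes sum: "padic_abs (u + v) < 1" and prod: "padic_abs (u * v - 1) < 1"
  shows "padic_abs (u\<^sup>2 + 1) < 1" "padic_abs u = 1"
proof -
  have uv: "padic_abs (u * v) = 1" using padic_abs_eq_of_close[of "u * v" 1] prod by simp
  have "padic_abs u \<le> 1"
  proof (rule ccontr)
    assume gt: "\<not> padic_abs u \<le> 1"
    have "u\<^sup>2 = u * (u + v) - u * v" by (simp add: power2_eq_square algebra_simps)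
    then have "padic_abs u * padic_abs u \<le> max (padic_abs (u * (u + v))) 1"
      using padic_abs_diff_le[of "u * (u + v)" "u * v"] uv
      by (metis padic_abs_mult power2_eq_square)
    also have "\<dots> \<le> padic_abs u"
      using gt mult_left_mono[of "padic_abs (u + v)" 1 "padic_abs u"] sum by (simp add: padic_abs_mult)
    finally show False using gt by simp
  qed
  then have "padic_abs (u * (u + v)) < 1" using padic_abs_mult_less_1[OF sum] by simp
  from padic_abs_diff_less[OF this prod] show sq: "padic_abs (u\<^sup>2 + 1) < 1"
    by (simp add: power2_eq_square algebra_simps)
  have "padic_abs (u\<^sup>2) = 1"
    using padic_abs_eq_of_close[of "u\<^sup>2" "- 1"] sq by (simp add: padic_abs_minus)
  then show "padic_abs u = 1"
    using padic_abs_nonneg[of u] by (simp add: padic_abs_power power2_eq_1_iff)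
qed

text \<open>
  All distances that the dynamics depends on equal \<open>r = \<bar>b - 1\<bar>\<close> or 1. In the product of
  \<open>fixed_equation_factored\<close>, of absolute value \<open>r\<close>, exactly one factor is a unit: the first for the
  fixed point near 1, the second for the other two.
\<close>

lemma fixed_points_geometry:
  fixes a b x0 x1 x2 :: "'p::prime_card padic"
  assumes two: "padic_abs (2 :: 'p padic) = 1"
    and ab: "padic_abs (a - 1) < padic_abs (b - 1)" and b: "padic_abs (b - 1) < 1"
    and fixed: "x0 * (b\<^sup>2 + x0\<^sup>2) = a * (b\<^sup>2 * x0\<^sup>2 + 1)"
      "x1 * (b\<^sup>2 + x1\<^sup>2) = a * (b\<^sup>2 * x1\<^sup>2 + 1)"
      "x2 * (b\<^sup>2 + x2\<^sup>2) = a * (b\<^sup>2 * x2\<^sup>2 + 1)"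
    and distinct: "x0 \<noteq> x1" "x0 \<noteq> x2" "x1 \<noteq> x2"
    and x0: "padic_abs (x0 - 1) < 1"
  shows "padic_abs a = 1" "padic_abs (b ^ 4 - 1) = padic_abs (b - 1)"
    "padic_abs (x1\<^sup>2 - x2\<^sup>2) = padic_abs (b - 1)"
    "\<And>c. c \<in> {x1, x2} \<Longrightarrow> padic_abs c = 1 \<and> padic_abs (c\<^sup>2 + 1) < 1
       \<and> padic_abs (c - a * b\<^sup>2) = 1 \<and> padic_abs (b\<^sup>2 + c\<^sup>2) = padic_abs (b - 1)"
proof -
  define r where "r = padic_abs (b - 1)"
  have r: "0 < r" "r < 1" "padic_abs (a - 1) < 1"
    using ab b padic_abs_nonneg[of "a - 1"] by (simp_all add: r_def)
  show a1: "padic_abs a = 1" using padic_abs_eq_of_close[of a 1] r by simp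
  have sq_sub_1: "padic_abs (u\<^sup>2 - 1) = padic_abs (u - 1)" if "padic_abs (u - 1) < 1" for u :: "'p padic"
  proof -
    have "u\<^sup>2 - 1 = (u - 1) * (u + 1)" by (simp add: power2_eq_square algebra_simps)
    then show ?thesis using padic_abs_add_1[OF two that] by (simp add: padic_abs_mult)
  qed
  have b2: "padic_abs (b\<^sup>2 - 1) = r" using sq_sub_1 b by (simp add: r_def)
  have "b ^ 4 - 1 = (b\<^sup>2)\<^sup>2 - 1" by simp
  then have b4: "padic_abs (b ^ 4 - 1) = r"
    using sq_sub_1[of "b\<^sup>2"] b2 r by metis
  then show "padic_abs (b ^ 4 - 1) = padic_abs (b - 1)" by (simp add: r_def)
  have factored: "padic_abs (b\<^sup>2 + c\<^sup>2) * padic_abs (c - a * b\<^sup>2) = r"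
    if "c * (b\<^sup>2 + c\<^sup>2) = a * (b\<^sup>2 * c\<^sup>2 + 1)" for c
    using arg_cong[OF fixed_equation_factored[OF that], of padic_abs] a1 b4
    by (simp add: padic_abs_mult padic_abs_minus)
  (* both squares are congruent to 1, so the first factor for x0 is congruent to the unit 2 *)
  have "padic_abs ((b\<^sup>2 + x0\<^sup>2) - 2) < 1"
    using padic_abs_add_less[of "b\<^sup>2 - 1" 1 "x0\<^sup>2 - 1"] b2 r sq_sub_1[OF x0] x0
    by (simp add: algebra_simps)
  then have "padic_abs (b\<^sup>2 + x0\<^sup>2) = 1"
    using padic_abs_eq_of_close[of "b\<^sup>2 + x0\<^sup>2" 2] two by simp
  then have "padic_abs (x0 - a * b\<^sup>2) = r" using factored[OF fixed(1)] by simp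
  moreover note vieta = fixed_points_vieta[OF fixed distinct]
  ultimately have sum: "padic_abs (x1 + x2) = r"
    by (simp add: padic_abs_minus_commute)
  have x0': "padic_abs x0 \<le> 1" using padic_abs_eq_of_close[of x0 1] x0 by simp
  have "padic_abs (x0 * (x1 + x2)) < 1" using padic_abs_mult_less_1[OF _ x0'] sum r by simp
  moreover have "x1 * x2 - 1 = (b\<^sup>2 - 1) - x0 * (x1 + x2)" using vieta(2) by simp
  ultimately have prod: "padic_abs (x1 * x2 - 1) < 1"
    using padic_abs_diff_less[of "b\<^sup>2 - 1" 1 "x0 * (x1 + x2)"] b2 r by metis
  have ab2: "padic_abs (a * b\<^sup>2 - 1) < 1"
  proof -
    have "padic_abs (a * (b\<^sup>2 - 1)) < 1" using a1 b2 r by (simp add: padic_abs_mult)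
    from padic_abs_add_less[OF this r(3)] show ?thesis by (simp add: algebra_simps)
  qed
  have main: "padic_abs c = 1 \<and> padic_abs (c\<^sup>2 + 1) < 1 \<and> padic_abs (c - a * b\<^sup>2) = 1
      \<and> padic_abs (b\<^sup>2 + c\<^sup>2) = r"
    if c: "padic_abs c = 1" "padic_abs (c\<^sup>2 + 1) < 1"
      and fx: "c * (b\<^sup>2 + c\<^sup>2) = a * (b\<^sup>2 * c\<^sup>2 + 1)" for c
  proof -
    (* the product is c^2 - 1, congruent to -2; hence c is not congruent to 1, nor to a b^2 *)
    have "padic_abs ((c - 1) * (c + 1)) = 1"
      using padic_abs_eq_of_close[of "(c - 1) * (c + 1)" "- 2"] c two
      by (simp add: padic_abs_minus power2_eq_square algebra_simps)
    then have "padic_abs (c - 1) = 1"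
      using padic_abs_eq_1_of_mult padic_abs_diff_le[of c 1] padic_abs_ultrametric[of c 1] c
      by (metis max.idem padic_abs_1)
    then have "padic_abs (c - a * b\<^sup>2) = 1"
      using padic_abs_eq_of_close[of "c - a * b\<^sup>2" "c - 1"] ab2 by (simp add: padic_abs_minus_commute)
    then show ?thesis using factored[OF fx] c by simp
  qed
  have c1: "padic_abs (x1\<^sup>2 + 1) < 1" "padic_abs x1 = 1"
    using small_sum_unit_product[of x1 x2] sum prod r by auto
  have c2: "padic_abs (x2\<^sup>2 + 1) < 1" "padic_abs x2 = 1"
    using small_sum_unit_product[of x2 x1] sum prod r by (auto simp: ac_simps)
  show "padic_abs c = 1 \<and> padic_abs (c\<^sup>2 + 1) < 1
       \<and> padic_abs (c - a * b\<^sup>2) = 1 \<and> padic_abs (b\<^sup>2 + c\<^sup>2) = padic_abs (b - 1)"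
    if "c \<in> {x1, x2}" for c
    using that main[OF c1(2,1) fixed(2)] main[OF c2(2,1) fixed(3)] by (auto simp: r_def)
  have "padic_abs (x1 - x2) = 1"
    using padic_abs_eq_of_close[of "x1 - x2" "2 * x1"] sum r two c1(2) padic_abs_minus[of "x1 + x2"]
    by (simp add: padic_abs_mult algebra_simps)
  moreover have "x1\<^sup>2 - x2\<^sup>2 = (x1 - x2) * (x1 + x2)"
    by (simp add: power2_eq_square algebra_simps)
  ultimately show "padic_abs (x1\<^sup>2 - x2\<^sup>2) = padic_abs (b - 1)"
    using sum by (simp add: padic_abs_mult r_def)
qed


section \<open>The symbolic metric\<close>

lemma prime_powi_inject:
  "real CARD('p::prime_card) powi m = real CARD('p) powi n \<longleftrightarrow> m = n"
  using prime_gt_1_nat[OF prime_card[where 'a = 'p]] power_int_strict_increasing[of m n "real CARD('p)"]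
    power_int_strict_increasing[of n m "real CARD('p)"] by (cases m n rule: linorder_cases) auto

lemma kappa_eqI:
  fixes c :: "nat \<Rightarrow> 'p::prime_card padic"
  assumes "padic_abs (c i - c j) = real CARD('p) powi (- m)"
  shows "kappa c i j = m"
  unfolding kappa_def using assms by (auto simp: prime_powi_inject)

lemma tau_eqI:
  fixes c :: "nat \<Rightarrow> 'p::prime_card padic"
  assumes scaling: "\<And>u v. u \<in> ball (c j) \<rho> \<Longrightarrow> v \<in> ball (c j) \<rho> \<Longrightarrow>
      padic_abs (f u - f v) = real CARD('p) powi t * padic_abs (u - v)" and "0 < \<rho>"
  shows "tau f \<rho> c j = t"
  unfolding tau_def
proof (rule the_equality)
  show "\<forall>u\<in>ball (c j) \<rho>. \<forall>v\<in>ball (c j) \<rho>.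
      padic_abs (f u - f v) = real CARD('p) powi t * padic_abs (u - v)"
    using scaling by blast
next
  fix t' assume t': "\<forall>u\<in>ball (c j) \<rho>. \<forall>v\<in>ball (c j) \<rho>.
      padic_abs (f u - f v) = real CARD('p) powi t' * padic_abs (u - v)"
  obtain n where n: "(1 / real CARD('p)) ^ n < \<rho>"
    using real_arch_pow_inv[OF \<open>0 < \<rho>\<close>, of "1 / real CARD('p)"]
      prime_gt_1_nat[OF prime_card[where 'a = 'p]] by auto
  (* a ball of positive radius contains two distinct points, so the ratio is determined *)
  define e :: "'p padic" where "e = of_nat CARD('p) ^ n"
  have e: "padic_abs e = (1 / real CARD('p)) ^ n" by (simp only: e_def padic_abs_power padic_abs_p)
  have "c j \<in> ball (c j) \<rho>" "c j - e \<in> ball (c j) \<rho>"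
    using n e \<open>0 < \<rho>\<close> by (simp_all add: dist_padic_def)
  moreover have "c j - (c j - e) = e" by simp
  ultimately have "real CARD('p) powi t * padic_abs e = real CARD('p) powi t' * padic_abs e"
    using scaling t' by metis
  moreover have "padic_abs e \<noteq> 0" using e by simp
  ultimately show "t' = t" by (auto simp: prime_powi_inject)
qed

section \<open>The conjugacy\<close>

theorem theorem5p7:
  fixes a b :: "'p::prime_card padic"
    and x :: "nat \<Rightarrow> 'p padic"
    and r :: real
    and X J :: "'p padic set"
    and k :: "'p padic \<Rightarrow> 'p padic"
    and d :: "(nat \<Rightarrow> nat) \<Rightarrow> (nat \<Rightarrow> nat) \<Rightarrow> real"
  assumes "CARD('p) \<ge> 3"
    and "a \<in> E_p" and "b \<in> E_p"
    and "padic_abs (a - 1) < padic_abs (b - 1)"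
    and "g_fixed_points a b = {x 0, x 1, x 2}" and "distinct [x 0, x 1, x 2]"
    and "x 0 \<in> E_p"
    and r_def: "r = padic_abs (b - 1)"
    and X_def: "X = ball ((x 1)\<^sup>2) r \<union> ball ((x 2)\<^sup>2) r"
    and k_def: "k = k_map a b"
    and J_def: "J = julia_set X k"
    and d_def: "d = shift_dist CARD('p) (tau k r (\<lambda>j. (x j)\<^sup>2)) (kappa (\<lambda>j. (x j)\<^sup>2))"
  shows "\<exists>h. bij_betw h J shift_space
           \<and> (\<forall>u\<in>J. h (k u) = left_shift (h u))
           \<and> (\<forall>u\<in>J. \<forall>v\<in>J. d (h u) (h v) = padic_abs (u - v))"
proof -
  have two: "padic_abs (2 :: 'p padic) = 1" by (rule padic_abs_2[OF assms(1)])
  have mem: "x j * (b\<^sup>2 + (x j)\<^sup>2) = a * (b\<^sup>2 * (x j)\<^sup>2 + 1)" if "j \<in> {0, 1, 2}" for j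
    using assms(5) that g_fixed_points_iff[of "x j" a b] by auto
  have r: "0 < r" "r < 1"
    using assms(3,4) padic_abs_nonneg[of "a - 1"] by (auto simp: r_def E_p_def)
  have b: "padic_abs (b - 1) < 1" and x0: "padic_abs (x 0 - 1) < 1"
    using assms(3,7) by (simp_all add: E_p_def)
  have distinct: "x 0 \<noteq> x 1" "x 0 \<noteq> x 2" "x 1 \<noteq> x 2" using assms(6) by simp_all
  have geometry: "padic_abs a = 1" "padic_abs (b ^ 4 - 1) = r" "padic_abs ((x 1)\<^sup>2 - (x 2)\<^sup>2) = r"
    "\<And>c. c \<in> {x 1, x 2} \<Longrightarrow> padic_abs c = 1 \<and> padic_abs (c\<^sup>2 + 1) < 1
       \<and> padic_abs (c - a * b\<^sup>2) = 1 \<and> padic_abs (b\<^sup>2 + c\<^sup>2) = r"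
    using fixed_points_geometry[OF two assms(4) b mem[of 0] mem[of 1] mem[of 2] distinct x0]
    unfolding r_def by (simp_all only: insert_iff simp_thms)
  have branch: "padic_abs (x j) = 1" "padic_abs ((x j)\<^sup>2 + 1) < 1"
      "padic_abs (x j - a * b\<^sup>2) = 1" "padic_abs (b\<^sup>2 + (x j)\<^sup>2) = r" if "j \<in> {1, 2}" for j
    using geometry(4)[of "x j"] that by auto
  have k_expanding: "padic_abs (k u - k v) = padic_abs (u - v) / r"
    if "j \<in> {1, 2}" "u \<in> ball ((x j)\<^sup>2) r" "v \<in> ball ((x j)\<^sup>2) r" for j u v
    unfolding k_def using that mem[of j] branch[OF that(1)] geometry r
    by (intro k_map_expanding[OF two, where c = "x j"])
       (auto simp: dist_padic_def padic_abs_minus_commute[of "(x j)\<^sup>2"])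
  have unit_ball: "ball ((x j)\<^sup>2) 1 = ball (- 1) 1" if "j \<in> {1, 2}" for j
    using branch(2)[OF that] by (intro padic_ball_eqI) simp
  have small_balls: "ball ((x j)\<^sup>2) r \<subseteq> ball (- 1) 1" if "j \<in> {1, 2}" for j
    using subset_ball[of r 1 "(x j)\<^sup>2"] r unit_ball[OF that] by simp
  have centres: "padic_abs ((x i)\<^sup>2 - (x j)\<^sup>2) = r" if "i \<in> {1, 2}" "j \<in> {1, 2}" "i \<noteq> j" for i j
    using that geometry(3) by (auto simp: padic_abs_minus_commute)
  have apart: "dist u v = r"
    if "i \<in> {1, 2}" "j \<in> {1, 2}" "i \<noteq> j" "u \<in> ball ((x i)\<^sup>2) r" "v \<in> ball ((x j)\<^sup>2) r" for i j u v
    using dist_points_of_padic_balls[OF that(4,5)] centres[OF that(1-3)] by simp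
  interpret full_expanding_branches "{1, 2}" "\<lambda>j. ball ((x j)\<^sup>2) r" "ball (- 1) 1" k
    "\<lambda>_. 1 / r" "1 / r" "\<lambda>_ _. r"
  proof unfold_locales
    show "k ` ball ((x j)\<^sup>2) r = ball (- 1) 1" if "j \<in> {1, 2}" for j
      unfolding k_def unit_ball[OF that, symmetric]
      using that mem[of j] by (intro k_map_image_ball[OF two geometry(1,2) r(1)] branch) auto
    show "ball ((x i)\<^sup>2) r \<inter> ball ((x j)\<^sup>2) r = {}" if "i \<in> {1, 2}" "j \<in> {1, 2}" "i \<noteq> j" for i j
      using apart[OF that] r by fastforce
    show "dist (k u) (k v) = 1 / r * dist u v"
      if "j \<in> {1, 2}" "u \<in> ball ((x j)\<^sup>2) r" "v \<in> ball ((x j)\<^sup>2) r" for j u v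
      using k_expanding[OF that] by (simp add: dist_padic_def)
    show "dist u v = r"
      if "i \<in> {1, 2}" "j \<in> {1, 2}" "i \<noteq> j" "u \<in> ball ((x i)\<^sup>2) r" "v \<in> ball ((x j)\<^sup>2) r" for i j u v
      using that by (rule apart)
    show "ball ((x j)\<^sup>2) r \<subseteq> ball (- 1) 1" if "j \<in> {1, 2}" for j
      using that by (rule small_balls)
  qed (use r in \<open>simp_all add: closed_padic_ball\<close>)
  (* m is the valuation of b - 1 and the common value of both tau's and both kappa's *)
  obtain m where m: "r = real CARD('p) powi (- m)"
    using padic_abs_eq_powi[of "b - 1"] r unfolding r_def by (metis less_irrefl padic_abs_0)
  have scale_eq: "real CARD('p) powi m = 1 / r" by (simp add: m power_int_minus divide_inverse)
  have tau: "tau k r (\<lambda>j. (x j)\<^sup>2) j = m" if "j \<in> {1, 2}" for j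
  proof (rule tau_eqI[OF _ r(1)])
    fix u v assume "u \<in> ball ((x j)\<^sup>2) r" "v \<in> ball ((x j)\<^sup>2) r"
    from k_expanding[OF that this]
    show "padic_abs (k u - k v) = real CARD('p) powi m * padic_abs (u - v)"
      unfolding scale_eq by simp
  qed
  have kappa: "kappa (\<lambda>j. (x j)\<^sup>2) i j = m" if "i \<in> {1, 2}" "j \<in> {1, 2}" "i \<noteq> j" for i j
    using centres[OF that] m by (intro kappa_eqI) simp
  have J: "J = julia_set (\<Union>i\<in>{1, 2}. ball ((x i)\<^sup>2) r) k"
    by (simp add: J_def X_def)
  have d_eq: "d s t = r / (\<Prod>i<n. 1 / r)"
    if "s \<in> shift_space" "t \<in> shift_space" "\<forall>i<n. s i = t i" "s n \<noteq> t n" for s t n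
  proof -
    have mem12: "s i \<in> {1, 2}" "t i \<in> {1, 2}" for i
      using that(1,2) by (auto simp: shift_space_def)
    have least: "(LEAST i. s i \<noteq> t i) = n"
      using that(3,4) by (intro Least_equality) (auto simp: not_less[symmetric])
    have "s \<noteq> t" using that(4) by auto
    then have "d s t = real CARD('p) powi (- (int n * m) - m)"
      unfolding d_def shift_dist_def Let_def least
      using kappa[OF mem12 that(4)] that(4) tau[OF mem12(1)] by (cases "n = 0") auto
    also have "\<dots> = real CARD('p) powi (- m) * (real CARD('p) powi (- m)) ^ n"
      by (simp add: power_int_power' power_int_diff power_int_minus field_simps)
    finally show ?thesis by (simp add: m[symmetric] power_one_over)
  qed
  note conjugacy = conjugate_to_full_shift[folded J shift_space_def]
  have "d (itinerary u) (itinerary v) = padic_abs (u - v)" if uv: "u \<in> J" "v \<in> J" for u v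
  proof (cases "u = v")
    case True
    then show ?thesis by (simp add: d_def shift_dist_def)
  next
    case False
    then have "itinerary u \<noteq> itinerary v"
      using uv conjugacy(1) by (auto simp: bij_betw_def inj_on_def)
    then obtain n where n: "\<forall>i<n. itinerary u i = itinerary v i" "itinerary u n \<noteq> itinerary v n"
      using exists_least_iff[of "\<lambda>i. itinerary u i \<noteq> itinerary v i"] by (auto simp: fun_eq_iff)
    have "itinerary u \<in> shift_space" "itinerary v \<in> shift_space"
      using uv conjugacy(1) by (auto simp: bij_betw_def)
    from d_eq[OF this n] show ?thesis
      using conjugacy(3) uv n by (simp add: dist_padic_def)
  qed
  then show ?thesis using conjugacy(1,2) by blast
qed

end
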